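(* Let $(\mathcal{N},\|\cdot\|)$ be a real normed space, endowed with its norm topology and Borel $\sigma$-algebra $\mathcal{B}$, such that the addition $(x,y)\mapsto x+y$ is measurable from $(\mathcal{N}^2,\mathcal{B}\otimes\mathcal{B})$ to $(\mathcal{N},\mathcal{B})$ (a measurable normed space). Let $(X_n)_{n\ge1}$ be a sequence of independent and identically distributed $(\mathcal{N},\mathcal{B})$-valued random variables and $\overline{X}_n=(X_1+\dots+X_n)/n$. Then $(\overline{X}_n,n)_{n\ge1}$ satisfies a weak large deviation principle, and its entropy satisfies $s=-p^*$, where $p(\lambda)=\log\mathbb{E}(e^{\lambda(X_1)})$ for $\lambda\in\mathcal{N}^*$.
   Context: $\mathcal{N}^*$ is the topological dual. Entropy: $s(x)=\inf_{r>0}\liminf_n\frac1n\log\mathbb{P}(\overline{X}_n\in B(x,r))$, with $B(x,r)$ the open ball. $p^*(x)=\sup_{\lambda\in\mathcal{N}^*}(\lambda(x)-p(\lambda))$. Weak large deviation principle: (i) for every Borel $G$, $\liminf_n\frac1n\log\mathbb{P}(\overline{X}_n\in G)\ge\sup_{x\in\mathrm{int}\,G}s(x)$; (ii) for every Borel relatively compact $K$, $\limsup_n\frac1n\log\mathbb{P}(\overline{X}_n\in K)\le\sup_{x\in\overline{K}}s(x)$. *)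

theory Defs
  imports "HOL-Probability.Probability"
begin

definition Xbar :: "(nat \<Rightarrow> 'b \<Rightarrow> 'a::real_normed_vector) \<Rightarrow> nat \<Rightarrow> 'b \<Rightarrow> 'a" where
  "Xbar X n \<omega> = (1 / real n) *\<^sub>R (\<Sum>i\<in>{1..n}. X i \<omega>)"

definition log_prob :: "real \<Rightarrow> ereal" where
  "log_prob q = (if q = 0 then -\<infinity> else ereal (ln q))"

definition ldp_entropy :: "'b measure \<Rightarrow> (nat \<Rightarrow> 'b \<Rightarrow> 'a::metric_space) \<Rightarrow> 'a \<Rightarrow> ereal" where
  "ldp_entropy M Y x =
     (INF r\<in>{0<..}. liminf (\<lambda>n. ereal (1 / real n) *
        log_prob (measure M {\<omega>\<in>space M. Y n \<omega> \<in> ball x r})))"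

definition weak_LDP :: "'b measure \<Rightarrow> (nat \<Rightarrow> 'b \<Rightarrow> 'a::metric_space) \<Rightarrow> ('a \<Rightarrow> ereal) \<Rightarrow> bool" where
  "weak_LDP M Y s \<longleftrightarrow>
     (\<forall>G\<in>sets borel.
        liminf (\<lambda>n. ereal (1 / real n) * log_prob (measure M {\<omega>\<in>space M. Y n \<omega> \<in> G}))
          \<ge> (SUP x\<in>interior G. s x)) \<and>
     (\<forall>K\<in>sets borel. compact (closure K) \<longrightarrow>
        limsup (\<lambda>n. ereal (1 / real n) * log_prob (measure M {\<omega>\<in>space M. Y n \<omega> \<in> K}))
          \<le> (SUP x\<in>closure K. s x))"

definition log_mgf :: "'b measure \<Rightarrow> (nat \<Rightarrow> 'b \<Rightarrow> 'a::real_normed_vector) \<Rightarrow> ('a \<Rightarrow> real) \<Rightarrow> ereal" where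
  "log_mgf M X l =
     (let I = (\<integral>\<^sup>+ \<omega>. ennreal (exp (l (X 1 \<omega>))) \<partial>M)
      in if I = \<infinity> then \<infinity> else ereal (ln (enn2real I)))"

definition legendre :: "'b measure \<Rightarrow> (nat \<Rightarrow> 'b \<Rightarrow> 'a::real_normed_vector) \<Rightarrow> 'a \<Rightarrow> ereal" where
  "legendre M X x = (SUP l\<in>{l. bounded_linear l}. ereal (l x) - log_mgf M X l)"

end

theory Submission
  imports Defs
begin

text \<open>Supermultiplicativity of the probabilities that the sum of \<open>n\<close> terms lies in a ball of radius
  \<open>n r\<close> gives, as in Fekete's lemma, \<open>P (Xbar n \<in> ball x r) \<le> exp (n s(x, r))\<close> for every \<open>n \<ge> 1\<close>,
  where \<open>s(x, r)\<close> is the exponential rate of the ball. Finite covers then yield the weak large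
  deviation principle, and \<open>s \<le> - p*\<close> is Chernoff's bound. For \<open>s \<ge> - p*\<close>, the Hahn--Banach theorem
  provides a functional \<open>l\<close> with \<open>l(w) + s(x, r) \<le> l(x0) - c\<close> for all \<open>w \<in> ball x r\<close>, whenever
  \<open>c < - s(x0)\<close>; summing over finitely many balls that cover a convex set \<open>K\<close> gives
  \<open>E (exp (l(X 1)); X 1 \<in> K) ^ n \<le> N * exp (n (l(x0) - c))\<close>, hence \<open>p(l) \<le> l(x0) - c\<close> once \<open>K\<close>
  exhausts the law of \<open>X 1\<close>. Such sets exist because measurability of the addition forces every finite
  Borel measure to be carried by countably many balls of any given radius.\<close>

section \<open>Separation by a bounded linear functional\<close>

text \<open>Supermultiplicativity holds only when radii are allowed to add, so the duality step
  never lets a radius shrink: one radius is fixed and every estimate holds for each single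
  \<open>n\<close>, without error term. This precision makes the sum over balls useful. The mean of
  \<open>n\<close> points of a convex set \<open>K\<close> stays in \<open>K\<close>, so the same
  \<open>N\<close> balls serve all \<open>n\<close>, and \<open>N\<close> disappears when
  \<open>n\<close>-th roots are taken; a cover growing with \<open>n\<close> could spoil the
  exponential rate. On a nonseparable space a Borel probability might a priori vanish on all small
  balls. Excluding this is a question of set theory, separate from the probabilistic part, and it is
  settled through measurability of the addition. The separating hyperplane lives in
  \<open>'a \<times> real\<close> and may be vertical. It then carries no information on rates, only
  on where the law of \<open>X 1\<close> sits relative to \<open>x0\<close>, and a large multiple of
  the functional replaces the normalised slope.\<close>

definition sublinear :: "('a::real_vector \<Rightarrow> real) \<Rightarrow> bool" where
  "sublinear p \<longleftrightarrow> (\<forall>x y. p (x + y) \<le> p x + p y) \<and> (\<forall>c x. 0 < c \<longrightarrow> p (c *\<^sub>R x) \<le> c * p x)"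

text \<open>Homogeneity is assumed only as an inequality for positive scalars, so the value at 0 is
  pinned from two sides, by the factors 2 and 1/2.\<close>

lemma sublinear_zero:
  assumes "sublinear p" shows "p 0 = 0"
proof -
  have "p 0 \<le> 2 * p 0" "p 0 \<le> (1/2) * p 0"
    using assms unfolding sublinear_def
    by (metis scaleR_zero_right zero_less_numeral, metis scaleR_zero_right half_gt_zero_iff zero_less_one)
  then show ?thesis by simp
qed

lemma sublinear_neg:
  assumes "sublinear p" shows "- p (- x) \<le> p x"
proof -
  have "p (x + - x) \<le> p x + p (- x)" using assms unfolding sublinear_def by blast
  then show ?thesis using sublinear_zero[OF assms] by simp
qed

text \<open>A minimal sublinear functional is linear.\<close>

lemma Hahn_Banach_sublinear:
  fixes p :: "'a::real_vector \<Rightarrow> real"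
  assumes p: "sublinear p"
  shows "\<exists>f. linear f \<and> (\<forall>x. f x \<le> p x)"
proof -
  define A where "A = {q. sublinear q \<and> q \<le> p}"
  \<comment> \<open>The order is reversed, so that the maximal element supplied by Zorn's lemma is a
    minimal sublinear functional.\<close>
  define P where "P = (\<lambda>q r::'a \<Rightarrow> real. r \<le> q)"
  have po: "partial_order_on A (relation_of P A)"
    unfolding P_def by (rule partial_order_on_relation_ofI) auto
  \<comment> \<open>A bound independent of \<open>q\<close>, so that the pointwise infimum of a
    chain is finite.\<close>
  have lower: "- p (- x) \<le> q x" if "q \<in> A" for q x
  proof -
    have "q (- x) \<le> p (- x)" using that by (auto simp: A_def le_fun_def)
    then show ?thesis using sublinear_neg[of q x] that by (auto simp: A_def)
  qed
  have "\<exists>m\<in>A. \<forall>a\<in>A. P m a \<longrightarrow> a = m"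
  proof (rule predicate_Zorn[OF po])
    fix C assume C: "C \<in> Chains (relation_of P A)"
    then have CA: "C \<subseteq> A" and ch: "\<And>a b. a \<in> C \<Longrightarrow> b \<in> C \<Longrightarrow> a \<le> b \<or> b \<le> a"
      unfolding Chains_def relation_of_def P_def by auto
    show "\<exists>u\<in>A. \<forall>a\<in>C. P a u"
    proof (cases "C = {}")
      case True
      then show ?thesis using p by (auto simp: A_def)
    next
      case False
      define u where "u = (\<lambda>x. INF q\<in>C. q x)"
      have bdd: "bdd_below ((\<lambda>q. q x) ` C)" for x
        by (rule bdd_belowI[of _ "- p (- x)"]) (use lower CA in auto)
      have le: "u x \<le> q x" if "q \<in> C" for q x
        unfolding u_def by (rule cINF_lower[OF bdd that])
      have "u (x + y) \<le> u x + u y" for x y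
      proof -
        have *: "u (x + y) \<le> q x + r y" if qr: "q \<in> C" "r \<in> C" for q r
        proof -
          obtain s where s: "s \<in> C" "s \<le> q" "s \<le> r" using ch[OF qr] qr by auto
          have "u (x + y) \<le> s (x + y)" by (rule le[OF s(1)])
          also have "\<dots> \<le> s x + s y" using s(1) CA by (auto simp: A_def sublinear_def)
          also have "\<dots> \<le> q x + r y" using s by (auto simp: le_fun_def intro: add_mono)
          finally show ?thesis .
        qed
        have "u (x + y) - q x \<le> u y" if "q \<in> C" for q
          unfolding u_def[THEN fun_cong, of y] using *[OF that] False
          by (intro cINF_greatest) (auto simp: algebra_simps)
        then have "u (x + y) - u y \<le> u x"
          unfolding u_def[THEN fun_cong, of x] using False
          by (intro cINF_greatest) (auto simp: algebra_simps)
        then show ?thesis by simp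
      qed
      moreover have "u (c *\<^sub>R x) \<le> c * u x" if c: "0 < c" for c x
      proof -
        have "u (c *\<^sub>R x) / c \<le> u x"
          unfolding u_def[THEN fun_cong, of x]
        proof (intro cINF_greatest False)
          fix q assume q: "q \<in> C"
          have "u (c *\<^sub>R x) \<le> q (c *\<^sub>R x)" by (rule le[OF q])
          also have "\<dots> \<le> c * q x" using q CA c by (auto simp: A_def sublinear_def)
          finally show "u (c *\<^sub>R x) / c \<le> q x" using c by (simp add: field_simps)
        qed
        then show ?thesis using c by (simp add: field_simps)
      qed
      moreover have "u \<le> p" unfolding le_fun_def
      proof
        fix x
        obtain q where "q \<in> C" using False by auto
        then have "u x \<le> q x" "q x \<le> p x" using le CA by (auto simp: A_def le_fun_def)
        then show "u x \<le> p x" by simp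
      qed
      ultimately have "u \<in> A" by (auto simp: A_def sublinear_def)
      then show ?thesis using le by (auto simp: P_def le_fun_def)
    qed
  qed
  then obtain q where q: "q \<in> A" and min: "\<And>r. r \<in> A \<Longrightarrow> r \<le> q \<Longrightarrow> r = q"
    by (auto simp: P_def)
  have sq: "sublinear q" and qadd: "\<And>x y. q (x + y) \<le> q x + q y"
    and qscale: "\<And>c x. 0 < c \<Longrightarrow> q (c *\<^sub>R x) \<le> c * q x"
    using q by (auto simp: A_def sublinear_def)
  have sup: "q x + q y \<le> q (x + y)" for x y
  proof -
    \<comment> \<open>\<open>q\<close> is lowered as far as possible along the direction
      \<open>y\<close>. The infimum \<open>r\<close> is again sublinear and below \<open>q\<close>,
      so minimality gives \<open>r = q\<close>; comparing with \<open>t = 1\<close> yields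
      superadditivity.\<close>
    define F where "F = (\<lambda>t x. q (x + t *\<^sub>R y) - t * q y)"
    define r where "r = (\<lambda>x. INF t\<in>{0..}. F t x)"
    have Fl: "- q (- x) \<le> F t x" if "0 \<le> t" for t x
    proof -
      have "q (t *\<^sub>R y) = t * q y"
      proof (cases "t = 0")
        case True then show ?thesis using sublinear_zero[OF sq] by simp
      next
        case False
        then have t: "0 < t" using that by simp
        have "q y \<le> (1/t) * q (t *\<^sub>R y)" using qscale[of "1/t" "t *\<^sub>R y"] t by simp
        then show ?thesis using qscale[OF t, of y] t by (simp add: field_simps)
      qed
      moreover have "q (t *\<^sub>R y) \<le> q (x + t *\<^sub>R y) + q (- x)"
        using qadd[of "x + t *\<^sub>R y" "- x"] by simp
      ultimately show ?thesis by (simp add: F_def)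
    qed
    have bdd: "bdd_below ((\<lambda>t. F t x) ` {0..})" for x
      by (rule bdd_belowI[of _ "- q (- x)"]) (use Fl in auto)
    have rle: "r x \<le> F t x" if "0 \<le> t" for t x
      unfolding r_def by (rule cINF_lower[OF bdd]) (use that in auto)
    have "r (x + x') \<le> r x + r x'" for x x'
    proof -
      have *: "r (x + x') \<le> F t x + F t' x'" if "0 \<le> t" "0 \<le> t'" for t t'
      proof -
        have "r (x + x') \<le> F (t + t') (x + x')" by (rule rle) (use that in simp)
        also have "\<dots> = q ((x + t *\<^sub>R y) + (x' + t' *\<^sub>R y)) - (t + t') * q y"
          by (simp add: F_def algebra_simps)
        also have "\<dots> \<le> F t x + F t' x'"
          using qadd[of "x + t *\<^sub>R y" "x' + t' *\<^sub>R y"] by (simp add: F_def algebra_simps)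
        finally show ?thesis .
      qed
      have "r (x + x') - F t x \<le> r x'" if "0 \<le> t" for t
        unfolding r_def[THEN fun_cong, of x'] using *[OF that]
        by (intro cINF_greatest) (auto simp: algebra_simps)
      then have "r (x + x') - r x' \<le> r x"
        unfolding r_def[THEN fun_cong, of x]
        by (intro cINF_greatest) (auto simp: algebra_simps)
      then show ?thesis by simp
    qed
    moreover have "r (c *\<^sub>R x) \<le> c * r x" if c: "0 < c" for c x
    proof -
      have "r (c *\<^sub>R x) / c \<le> r x"
        unfolding r_def[THEN fun_cong, of x]
      proof (intro cINF_greatest)
        fix t :: real assume t: "t \<in> {0..}"
        have "r (c *\<^sub>R x) \<le> F (c * t) (c *\<^sub>R x)" by (rule rle) (use t c in simp)
        also have "\<dots> = q (c *\<^sub>R (x + t *\<^sub>R y)) - c * t * q y" by (simp add: F_def algebra_simps)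
        also have "\<dots> \<le> c * F t x" using qscale[OF c, of "x + t *\<^sub>R y"] by (simp add: F_def algebra_simps)
        finally show "r (c *\<^sub>R x) / c \<le> F t x" using c by (simp add: field_simps)
      qed simp
      then show ?thesis using c by (simp add: field_simps)
    qed
    moreover have "r \<le> q" using rle[of 0] by (auto simp: le_fun_def F_def)
    ultimately have "r = q" using q by (intro min) (auto simp: A_def sublinear_def)
    then have "q x \<le> F 1 x" using rle[of 1 x] by simp
    then show ?thesis by (simp add: F_def)
  qed
  have add: "q (x + y) = q x + q y" for x y using sup[of x y] qadd[of x y] by simp
  have neg: "q (- x) = - q x" for x using add[of x "- x"] sublinear_zero[OF sq] by simp
  have pos: "q (c *\<^sub>R x) = c * q x" if c: "0 < c" for c x
  proof -
    have "q x \<le> (1/c) * q (c *\<^sub>R x)" using qscale[of "1/c" "c *\<^sub>R x"] c by simp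
    then show ?thesis using qscale[OF c, of x] c by (simp add: field_simps)
  qed
  have "q (c *\<^sub>R x) = c * q x" for c x
  proof -
    consider "0 < c" | "c = 0" | "0 < - c" by linarith
    then show ?thesis
    proof cases
      case 3
      then show ?thesis using pos[of "- c" x] neg[of "c *\<^sub>R x"] by simp
    qed (use pos sublinear_zero[OF sq] in auto)
  qed
  then have "linear q" using add by (intro linearI) auto
  then show ?thesis using q by (auto simp: A_def le_fun_def)
qed

text \<open>Positive scaling turns \<open>Q\<close> into a convex cone without 0, which keeps its
  gauge relative to a point \<open>e\<close> of \<open>Q\<close> finite. The gauge is sublinear and
  dominated by a multiple of the norm, so a linear functional below it is bounded. It is nonnegative
  on the cone because the gauge of \<open>- x\<close> is at most 0 there, and positive on
  \<open>Q\<close> because openness allows a small step in the direction \<open>- e\<close>.\<close>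

lemma open_semigroup_positive_functional:
  fixes Q :: "'a::real_normed_vector set"
  assumes opn: "open Q" and ne: "Q \<noteq> {}"
    and add: "\<And>x y. x \<in> Q \<Longrightarrow> y \<in> Q \<Longrightarrow> x + y \<in> Q" and zero: "0 \<notin> Q"
  shows "\<exists>f :: 'a \<Rightarrow> real. bounded_linear f \<and> (\<forall>x\<in>Q. 0 < f x)"
proof -
  have mult: "real (Suc m) *\<^sub>R x \<in> Q" if "x \<in> Q" for m x
  proof (induction m)
    case (Suc m)
    have "real (Suc (Suc m)) *\<^sub>R x = real (Suc m) *\<^sub>R x + x" by (simp add: algebra_simps scaleR_2)
    then show ?case using add[OF Suc that] by simp
  qed (use that in simp)
  define P where "P = {s *\<^sub>R x | s x. 0 < s \<and> x \<in> Q}"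
  have QP: "Q \<subseteq> P"
    unfolding P_def by clarify (metis scaleR_one zero_less_one)
  have P0: "0 \<notin> P" using zero unfolding P_def by auto
  have Pscale: "c *\<^sub>R x \<in> P" if "0 < c" "x \<in> P" for c x
    using that unfolding P_def by (fastforce intro: mult_pos_pos)
  \<comment> \<open>So far only integer multiples stay in \<open>Q\<close>. Openness lets
    \<open>s\<close> be replaced by a slightly larger rational \<open>r\<close>, the vector being
    shrunk by \<open>s / r\<close>; a common denominator then brings sums back into
    \<open>Q\<close>.\<close>
  have ratl: "\<exists>m n y. y \<in> Q \<and> x = (real (Suc m) / real (Suc n)) *\<^sub>R y" if x: "x \<in> P" for x
  proof -
    obtain s y where s: "0 < s" and y: "y \<in> Q" and xe: "x = s *\<^sub>R y" using x unfolding P_def by auto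
    have "((\<lambda>r. (s / r) *\<^sub>R y) \<longlongrightarrow> (s / s) *\<^sub>R y) (at_right s)"
      using s by (intro tendsto_intros) auto
    then have "\<forall>\<^sub>F r in at_right s. (s / r) *\<^sub>R y \<in> Q"
      by (rule topological_tendstoD[OF _ opn]) (use s y in simp)
    then obtain b where b: "b > s" "\<And>r. s < r \<Longrightarrow> r < b \<Longrightarrow> (s / r) *\<^sub>R y \<in> Q"
      using eventually_at_right[of s "s + 1"] by auto
    obtain r where r: "r \<in> \<rat>" "s < r" "r < b" using Rats_dense_in_real[OF b(1)] by auto
    obtain m n :: nat where n: "n \<noteq> 0" and mn: "\<bar>r\<bar> = real m / real n"
      using Rats_abs_nat_div_natE[OF r(1)] by metis
    have "m \<noteq> 0" using mn r s by (intro notI) simp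
    obtain m' n' where "m = Suc m'" "n = Suc n'" using \<open>m \<noteq> 0\<close> n by (metis not0_implies_Suc)
    moreover have "x = r *\<^sub>R ((s / r) *\<^sub>R y)" using r s xe by simp
    ultimately show ?thesis using b(2)[OF r(2,3)] mn r s by (metis abs_of_pos less_trans)
  qed
  have Padd: "x + y \<in> P" if xy: "x \<in> P" "y \<in> P" for x y
  proof -
    obtain m n x' where x': "x' \<in> Q" "x = (real (Suc m) / real (Suc n)) *\<^sub>R x'" using ratl[OF xy(1)] by blast
    obtain k l y' where y': "y' \<in> Q" "y = (real (Suc k) / real (Suc l)) *\<^sub>R y'" using ratl[OF xy(2)] by blast
    define z where "z = real (Suc l) *\<^sub>R (real (Suc m) *\<^sub>R x') + real (Suc n) *\<^sub>R (real (Suc k) *\<^sub>R y')"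
    have "z \<in> Q" unfolding z_def by (intro add mult x' y')
    moreover have "x + y = (1 / (real (Suc n) * real (Suc l))) *\<^sub>R z"
      unfolding z_def x' y' by (simp add: scaleR_add_right del: of_nat_Suc)
    ultimately show ?thesis unfolding P_def by (intro CollectI exI[of _ "1 / (real (Suc n) * real (Suc l))"] exI[of _ z]) auto
  qed
  obtain e where e: "e \<in> Q" using ne by auto
  obtain d where d: "0 < d" "ball e d \<subseteq> Q" using opn e by (meson open_contains_ball)
  define T where "T = (\<lambda>x. {t. t *\<^sub>R e - x \<in> P})"
  define p where "p = (\<lambda>x. Inf (T x))"
  have Tbig: "t \<in> T x" if "norm x / d < t" for t x
  proof -
    have t: "0 < t" using that d by (smt (verit) divide_nonneg_pos norm_ge_zero)
    have "norm x / t < d" using that t d by (simp add: field_simps)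
    then have "e - (1/t) *\<^sub>R x \<in> ball e d" using t by (simp add: dist_norm)
    then have "t *\<^sub>R (e - (1/t) *\<^sub>R x) \<in> P" using d QP t by (intro Pscale) blast+
    then show ?thesis using t by (simp add: T_def algebra_simps)
  qed
  have Tlow: "- (norm x / d) \<le> t" if "t \<in> T x" for t x
  proof (rule ccontr)
    assume "\<not> ?thesis"
    then have "- t \<in> T (- x)" by (intro Tbig) simp
    then have "(t *\<^sub>R e - x) + ((- t) *\<^sub>R e - (- x)) \<in> P" using that by (intro Padd) (auto simp: T_def)
    then show False using P0 by simp
  qed
  have bdd: "bdd_below (T x)" for x by (rule bdd_belowI) (use Tlow in auto)
  have neT: "T x \<noteq> {}" for x using Tbig[of x "norm x / d + 1"] by auto
  have ple: "p x \<le> t" if "t \<in> T x" for x t unfolding p_def by (rule cInf_lower[OF that bdd])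
  have pnorm: "p x \<le> norm x / d" for x
    by (rule dense_ge) (use Tbig ple in auto)
  have "p (x + y) \<le> p x + p y" for x y
  proof -
    have *: "p (x + y) \<le> t + s" if "t \<in> T x" "s \<in> T y" for t s
    proof (rule ple)
      have "(t *\<^sub>R e - x) + (s *\<^sub>R e - y) \<in> P" using that by (intro Padd) (auto simp: T_def)
      then show "t + s \<in> T (x + y)" by (simp add: T_def algebra_simps)
    qed
    have "p (x + y) - t \<le> p y" if "t \<in> T x" for t
      unfolding p_def[THEN fun_cong, of y] using *[OF that] neT by (intro cInf_greatest) (auto simp: algebra_simps)
    then have "p (x + y) - p y \<le> p x"
      unfolding p_def[THEN fun_cong, of x] using neT by (intro cInf_greatest) (auto simp: algebra_simps)
    then show ?thesis by simp
  qed
  moreover have "p (c *\<^sub>R x) \<le> c * p x" if c: "0 < c" for c x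
  proof -
    have "p (c *\<^sub>R x) / c \<le> p x"
      unfolding p_def[THEN fun_cong, of x]
    proof (intro cInf_greatest neT)
      fix t assume "t \<in> T x"
      then have "c *\<^sub>R (t *\<^sub>R e - x) \<in> P" using c by (intro Pscale) (auto simp: T_def)
      then have "c * t \<in> T (c *\<^sub>R x)" by (simp add: T_def algebra_simps)
      then show "p (c *\<^sub>R x) / c \<le> t" using ple c by (fastforce simp: field_simps)
    qed
    then show ?thesis using c by (simp add: field_simps)
  qed
  ultimately have "sublinear p" by (simp add: sublinear_def)
  then obtain f where f: "linear f" and fp: "\<And>x. f x \<le> p x" using Hahn_Banach_sublinear by blast
  have fneg: "f (- x) = - f x" for x by (rule linear_neg[OF f])
  have "\<bar>f x\<bar> \<le> norm x * (1/d)" for x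
    using fp[of x] fp[of "- x"] pnorm[of x] pnorm[of "- x"] fneg[of x] by auto
  then have bl: "bounded_linear f"
    by (intro bounded_linear_intro[of f "1/d"] linear_add[OF f] linear_scale[OF f]) simp_all
  have nonneg: "0 \<le> f x" if "x \<in> P" for x
    using ple[of 0 "- x"] that fp[of "- x"] fneg[of x] by (auto simp: T_def)
  have fe: "1 \<le> f e"
  proof -
    have "p (- e) \<le> t" if "-1 < t" for t
    proof (rule ple)
      have "(t + 1) *\<^sub>R e \<in> P" using that e QP by (intro Pscale) auto
      then show "t \<in> T (- e)" by (simp add: T_def algebra_simps)
    qed
    then have "p (- e) \<le> -1" by (rule dense_ge)
    then show ?thesis using fp[of "- e"] fneg[of e] by simp
  qed
  have "0 < f x" if x: "x \<in> Q" for x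
  proof -
    obtain a where a: "0 < a" "ball x a \<subseteq> Q" using opn x by (meson open_contains_ball)
    have n: "0 < norm e" using e zero by auto
    define h where "h = a / (2 * norm e)"
    have h: "0 < h" "h * norm e < a" using a n by (auto simp: h_def)
    have "x - h *\<^sub>R e \<in> ball x a" using h by (simp add: dist_norm)
    then have "0 \<le> f (x - h *\<^sub>R e)" using a QP by (intro nonneg) blast
    then have "h * f e \<le> f x" using f by (simp add: linear_diff linear_scale)
    moreover have "0 < h * f e" using h fe by simp
    ultimately show ?thesis by linarith
  qed
  then show ?thesis using bl by (intro exI[of _ f]) auto
qed

section \<open>Borel measures on measurable normed spaces\<close>

text \<open>A ball of radius \<open>e / 2\<close> meets at most one of the sets, so the family is
  locally finite. The index set may be uncountable, which is how unions beyond the reach of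
  countable operations are shown to be Borel.\<close>

lemma closed_Union_separated:
  fixes F :: "'i \<Rightarrow> 'a::metric_space set"
  assumes "0 < e" and cl: "\<And>i. i \<in> A \<Longrightarrow> closed (F i)"
    and sep: "\<And>i j x y. i \<in> A \<Longrightarrow> j \<in> A \<Longrightarrow> i \<noteq> j \<Longrightarrow> x \<in> F i \<Longrightarrow> y \<in> F j \<Longrightarrow> e \<le> dist x y"
  shows "closed (\<Union>i\<in>A. F i)"
  unfolding closed_def open_dist
proof
  fix x assume x: "x \<in> - (\<Union>i\<in>A. F i)"
  show "\<exists>d>0. \<forall>y. dist y x < d \<longrightarrow> y \<in> - (\<Union>i\<in>A. F i)"
  proof (cases "\<exists>i\<in>A. \<exists>z\<in>F i. dist z x < e / 2")
    case False
    then show ?thesis using \<open>0 < e\<close> by (intro exI[of _ "e / 2"]) auto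
  next
    case True
    then obtain i z where iz: "i \<in> A" "z \<in> F i" "dist z x < e / 2" by auto
    obtain d where d: "0 < d" "\<And>y. dist y x < d \<Longrightarrow> y \<notin> F i"
      using cl[OF iz(1)] x iz(1) unfolding closed_def open_dist by force
    have "y \<notin> F j" if j: "j \<in> A" and y: "dist y x < min d (e / 2)" for j y
    proof
      assume "y \<in> F j"
      then have "j \<noteq> i" using d(2) y by auto
      then have "e \<le> dist z y" using sep[OF iz(1) j _ iz(2) \<open>y \<in> F j\<close>] by auto
      moreover have "dist z y \<le> dist z x + dist y x" by (rule dist_triangle2)
      ultimately show False using iz y by auto
    qed
    then show ?thesis using d \<open>0 < e\<close> by (intro exI[of _ "min d (e / 2)"]) auto
  qed
qed

text \<open>Montgomery's rank argument. Along a well-ordering of the space, the spans of initial segments grow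
  until their \<open>\<epsilon>\<close>-neighbourhoods acquire positive measure. Attaching to a point the first span whose
  neighbourhood contains it, and to that rank \<open>x\<close> a vector \<open>v x\<close> at distance 1 from the earlier spans,
  the sums \<open>v x + 2 v y\<close> with \<open>x\<close> before \<open>y\<close> form a closed discrete set. Measurability of the
  addition thus makes the comparison of ranks measurable in the product, contradicting Fubini's theorem.\<close>

lemma measurable_add_null_balls_imp_null:
  fixes \<mu> :: "'a::real_normed_vector measure"
  assumes add: "(\<lambda>(x, y). x + y) \<in> borel \<Otimes>\<^sub>M borel \<rightarrow>\<^sub>M (borel :: 'a measure)"
    and fin: "finite_measure \<mu>" and sets: "sets \<mu> = sets borel" and e: "0 < \<epsilon>"
    and balls: "\<And>x. emeasure \<mu> (ball x \<epsilon>) = 0"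
  shows "emeasure \<mu> UNIV = 0"
proof (rule ccontr)
  assume pos: "emeasure \<mu> UNIV \<noteq> 0"
  interpret finite_measure \<mu> by fact
  have sp: "space \<mu> = UNIV" using sets_eq_imp_space_eq[OF sets] by simp
  obtain r :: "'a rel" where r: "well_order_on UNIV r" using well_order_on by blast
  define lt where "lt = (\<lambda>x y. (x, y) \<in> r \<and> x \<noteq> y)"
  have wf: "wf {(x, y). lt x y}"
    using r by (auto simp: well_order_on_def lt_def intro: wf_subset)
  have tri: "lt x y \<or> x = y \<or> lt y x" for x y
    using r unfolding well_order_on_def linear_order_on_def total_on_def lt_def by blast
  have trans: "lt x z" if "lt x y" "lt y z" for x y z
  proof -
    have "Relation.trans r" "antisym r"
      using r by (auto simp: well_order_on_def linear_order_on_def partial_order_on_def preorder_on_def)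
    then show ?thesis using that transD[of r x y z] antisymD[of r x y] unfolding lt_def by auto
  qed
  have irrefl: "\<not> lt x x" for x by (simp add: lt_def)
  have asym: "\<not> lt y x" if "lt x y" for x y using that trans[of x y x] irrefl[of x] by auto
  have le_lt: "lt w y" if "\<not> lt x w" "lt x y" for w x y using that tri[of x w] trans[of w x y] by auto
  have lt_le: "lt w y" if "lt w x" "\<not> lt y x" for w x y using that tri[of x y] trans[of w x y] by auto
  define D where "D = (\<lambda>x. {y. \<not> lt x y})"
  define S where "S = (\<lambda>x. {y. lt y x})"
  have DS: "D x = insert x (S x)" for x using tri[of x] asym irrefl by (auto simp: D_def S_def)
  have DmonoS: "D x \<subseteq> S y" if "lt x y" for x y
    using le_lt[OF _ that] by (auto simp: D_def S_def)
  have Dmono: "D x \<subseteq> D y" if "\<not> lt y x" for x y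
    using lt_le[of y _ x] that by (auto simp: D_def)
  define nb :: "'a set \<Rightarrow> 'a \<Rightarrow> 'a set" where "nb = (\<lambda>L z. \<Union>l\<in>L. ball (z + l) \<epsilon>)"
  have nb_open: "open (nb L z)" for L z by (auto simp: nb_def)
  have nb_sets: "nb L z \<in> sets \<mu>" for L z using nb_open sets by auto
  have nb_mono: "nb L z \<subseteq> nb L' z" if "L \<subseteq> L'" for L L' z using that by (auto simp: nb_def)
  \<comment> \<open>All translates are required, because the multiple of a new generator
    \<open>a\<close> becomes a translation of the old span.\<close>
  define null where "null = (\<lambda>L. \<forall>z. nb L z \<in> null_sets \<mu>)"
  have null_mono: "null L" if "null L'" "L \<subseteq> L'" for L L'
    using that nb_mono nb_sets unfolding null_def by (meson null_sets_subset)
  \<comment> \<open>Open neighbourhoods permit replacing the real multiples of \<open>a\<close> by the rational ones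
    without enlarging the radius.\<close>
  have null_insert: "null (span (insert a A))" if "null (span A)" for a A
    unfolding null_def
  proof
    fix z
    have "nb (span (insert a A)) z \<subseteq> (\<Union>q\<in>\<rat>. nb (span A) (z + q *\<^sub>R a))"
    proof
      fix w assume "w \<in> nb (span (insert a A)) z"
      then obtain l where l: "l \<in> span (insert a A)" "dist (z + l) w < \<epsilon>" by (auto simp: nb_def)
      then obtain k where k: "l - k *\<^sub>R a \<in> span A" using span_breakdown_eq by blast
      define \<eta> where "\<eta> = (\<epsilon> - dist (z + l) w) / (norm a + 1)"
      have \<eta>: "0 < \<eta>" using l by (simp add: \<eta>_def add_nonneg_pos)
      obtain q where q: "q \<in> \<rat>" "k < q" "q < k + \<eta>" using Rats_dense_in_real[of k "k + \<eta>"] \<eta> by auto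
      have "dist (z + q *\<^sub>R a + (l - k *\<^sub>R a)) w = norm ((z + l - w) + (q - k) *\<^sub>R a)"
        by (simp add: dist_norm algebra_simps)
      also have "\<dots> \<le> dist (z + l) w + (q - k) * norm a"
        using q by (intro order_trans[OF norm_triangle_ineq]) (simp add: dist_norm)
      also have "(q - k) * norm a \<le> \<eta> * norm a" using q by (intro mult_right_mono) auto
      also have "\<eta> * norm a < \<eta> * (norm a + 1)" using \<eta> by simp
      also have "\<dots> = \<epsilon> - dist (z + l) w"
        unfolding \<eta>_def by (simp add: add_nonneg_eq_0_iff)
      finally have "dist (z + q *\<^sub>R a + (l - k *\<^sub>R a)) w < \<epsilon>" by simp
      then have "w \<in> nb (span A) (z + q *\<^sub>R a)" using k unfolding nb_def by (intro UN_I[OF k]) simp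
      then show "w \<in> (\<Union>q\<in>\<rat>. nb (span A) (z + q *\<^sub>R a))" using q by blast
    qed
    moreover have "(\<Union>q\<in>\<rat>. nb (span A) (z + q *\<^sub>R a)) \<in> null_sets \<mu>"
      using that by (intro null_sets_UN' countable_rat) (auto simp: null_def)
    ultimately show "nb (span (insert a A)) z \<in> null_sets \<mu>" using nb_sets by (meson null_sets_subset)
  qed
  define J where "J = {x. null (span (D x))}"
  have Jdown: "y \<in> J" if "x \<in> J" "\<not> lt x y" for x y
    using that null_mono[of "span (D x)" "span (D y)"] Dmono[of x y] by (auto simp: J_def span_mono)
  \<comment> \<open>If the span of \<open>J\<close> were null, then either \<open>J\<close> is
    everything and the whole space is null, or \<open>null_insert\<close> applied to the least point
    outside \<open>J\<close> would put that point into \<open>J\<close>.\<close>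
  have "\<not> null (span J)"
  proof
    assume nJ: "null (span J)"
    have "J \<noteq> UNIV"
    proof
      assume "J = UNIV"
      moreover have "nb UNIV 0 = UNIV" using e by (auto simp: nb_def intro!: UNIV_eq_I)
      ultimately have "UNIV \<in> null_sets \<mu>" using nJ unfolding null_def by (metis span_UNIV)
      then show False using pos by auto
    qed
    then obtain x where x: "x \<notin> J" "\<And>y. lt y x \<Longrightarrow> y \<in> J"
      using wfE_min[OF wf, of _ "- J"] by (metis (mono_tags, lifting) ComplD ComplI UNIV_eq_I case_prodI mem_Collect_eq)
    have "D x \<subseteq> insert x J" using x DS by (auto simp: S_def)
    then have "null (span (D x))" using null_mono[OF null_insert[OF nJ]] span_mono by blast
    then show False using x by (auto simp: J_def)
  qed
  then obtain z0 where z0: "nb (span J) z0 \<notin> null_sets \<mu>" by (auto simp: null_def)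
  \<comment> \<open>This ball is removed since the vector 0 lies in every span, even that of the
    empty set, and so singles out no index.\<close>
  define B0 where "B0 = ball z0 \<epsilon>"
  define U where "U = nb (span J) z0 - B0"
  have B0: "B0 \<in> null_sets \<mu>" using balls sets by (auto simp: B0_def null_sets_def)
  have U_sets: "U \<in> sets \<mu>" unfolding U_def using nb_sets B0 by auto
  have U_pos: "emeasure \<mu> U \<noteq> 0"
    using z0 nb_sets emeasure_Diff_null_set[OF B0 nb_sets] by (auto simp: U_def null_sets_def)
  define G where "G = (\<lambda>x. nb (span (D x)) z0)"
  define G' where "G' = (\<lambda>x. nb (span (S x)) z0)"
  have GG': "G x \<subseteq> G' y" if "lt x y" for x y
    unfolding G_def G'_def using DmonoS[OF that] by (intro nb_mono span_mono)
  have Gmono: "G x \<subseteq> G y" if "\<not> lt y x" for x y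
    unfolding G_def using Dmono[OF that] by (intro nb_mono span_mono)
  have Gnull: "G x \<in> null_sets \<mu>" if "x \<in> J" for x using that by (auto simp: J_def G_def null_def)
  \<comment> \<open>A finite combination lies in the span of the segment that ends at its largest
    generator.\<close>
  have span_D: "l = 0 \<or> (\<exists>x\<in>K. l \<in> span (D x))" if "l \<in> span K" for l K
    using that
  proof (induction rule: span_induct_alt)
    case (step c x y)
    have x: "c *\<^sub>R x \<in> span (D x)" by (intro span_scale span_base) (simp add: D_def irrefl)
    show ?case
    proof (cases "y = 0")
      case True
      then show ?thesis using x step by auto
    next
      case False
      then obtain w where w: "w \<in> K" "y \<in> span (D w)" using step by auto
      show ?thesis
      proof (cases "lt w x")
        case True
        then have "y \<in> span (D x)" using w span_mono[OF Dmono[of x w]] asym[OF True] by blast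
        then have "c *\<^sub>R x + y \<in> span (D x)" by (rule span_add[OF x])
        then show ?thesis using step by blast
      next
        case False
        then have "c *\<^sub>R x \<in> span (D w)" using x span_mono[OF Dmono[of w x]] False by blast
        then have "c *\<^sub>R x + y \<in> span (D w)" using w by (intro span_add) auto
        then show ?thesis using w by blast
      qed
    qed
  qed simp
  have nb_D: "\<exists>x\<in>K. z \<in> G x" if zK: "z \<in> nb (span K) z0" "z \<notin> B0" for z K
  proof -
    obtain l where l: "l \<in> span K" "z \<in> ball (z0 + l) \<epsilon>" using zK by (auto simp: nb_def)
    then have "l \<noteq> 0" using zK by (auto simp: B0_def)
    then show ?thesis using span_D[OF l(1)] l by (auto simp: G_def nb_def)
  qed
  \<comment> \<open>The choice is harmless: by \<open>rank_eq\<close> the rank is unique, since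
    \<open>G x\<close> is contained in \<open>G' y\<close> whenever \<open>x\<close> precedes
    \<open>y\<close>.\<close>
  define \<rho> where "\<rho> = (\<lambda>z. SOME x. x \<in> J \<and> z \<in> G x \<and> z \<notin> G' x)"
  have rank_ex: "\<exists>x. x \<in> J \<and> z \<in> G x \<and> z \<notin> G' x" if z: "z \<in> U" for z
  proof -
    have "\<exists>x. x \<in> {x \<in> J. z \<in> G x}" using nb_D[of z J] z by (auto simp: U_def)
    then obtain x where x: "x \<in> {x \<in> J. z \<in> G x}" "\<And>y. lt y x \<Longrightarrow> y \<notin> {x \<in> J. z \<in> G x}"
      using wfE_min[OF wf, of _ "{x \<in> J. z \<in> G x}"] by (metis (no_types, lifting) case_prodI mem_Collect_eq)
    have "z \<notin> G' x"
    proof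
      assume "z \<in> G' x"
      then obtain y where "lt y x" "z \<in> G y" using nb_D[of z "S x"] z by (auto simp: G'_def U_def S_def)
      then show False using x Jdown[of x y] asym[of y x] by blast
    qed
    then show ?thesis using x by blast
  qed
  have rank: "\<rho> z \<in> J" "z \<in> G (\<rho> z)" "z \<notin> G' (\<rho> z)" if "z \<in> U" for z
    using someI_ex[OF rank_ex[OF that]] by (auto simp: \<rho>_def)
  have rank_eq: "\<rho> z = x" if "z \<in> U" "z \<in> G x" "z \<notin> G' x" for z x
    using rank[OF that(1)] that tri[of x "\<rho> z"] GG' by blast
  define d where "d = (\<lambda>x. infdist x (span (S x)))"
  have ne: "span K \<noteq> {}" for K :: "'a set" using span_zero by blast
  \<comment> \<open>If \<open>\<rho> z\<close> were in the closure of the span of its predecessors,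
    a nearby vector \<open>s\<close> of that span could replace it in the approximation of
    \<open>z\<close>. The strict inequality leaves room for the error, and \<open>z\<close> would
    already lie in \<open>G' (\<rho> z)\<close>.\<close>
  have dpos: "0 < d (\<rho> z)" if z: "z \<in> U" for z
  proof (rule ccontr)
    assume "\<not> 0 < d (\<rho> z)"
    then have d0: "infdist (\<rho> z) (span (S (\<rho> z))) = 0" using infdist_nonneg[of "\<rho> z"] unfolding d_def by (meson antisym not_less)
    obtain l where l: "l \<in> span (D (\<rho> z))" "dist (z0 + l) z < \<epsilon>" using rank(2)[OF z] by (auto simp: G_def nb_def)
    obtain k where k: "l - k *\<^sub>R \<rho> z \<in> span (S (\<rho> z))" using l(1) span_breakdown_eq unfolding DS by blast
    define \<eta> where "\<eta> = (\<epsilon> - dist (z0 + l) z) / (\<bar>k\<bar> + 1)"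
    have \<eta>: "0 < \<eta>" using l by (simp add: \<eta>_def add_nonneg_pos)
    then have "\<exists>s\<in>span (S (\<rho> z)). dist (\<rho> z) s < \<eta>"
      using d0 ne infdist_notempty[of "span (S (\<rho> z))" "\<rho> z"]
        cINF_less_iff[of "span (S (\<rho> z))" "dist (\<rho> z)" \<eta>] by (auto intro: bdd_belowI2[of _ 0])
    then obtain s where s: "s \<in> span (S (\<rho> z))" "dist (\<rho> z) s < \<eta>" by blast
    have "l - k *\<^sub>R \<rho> z + k *\<^sub>R s \<in> span (S (\<rho> z))" by (intro span_add k span_scale s)
    moreover have "dist (z0 + (l - k *\<^sub>R \<rho> z + k *\<^sub>R s)) z < \<epsilon>"
    proof -
      have "dist (z0 + (l - k *\<^sub>R \<rho> z + k *\<^sub>R s)) z = norm ((z0 + l - z) - k *\<^sub>R (\<rho> z - s))"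
        by (simp add: dist_norm algebra_simps)
      also have "\<dots> \<le> dist (z0 + l) z + \<bar>k\<bar> * dist (\<rho> z) s"
        by (intro order_trans[OF norm_triangle_ineq4]) (simp add: dist_norm)
      also have "\<bar>k\<bar> * dist (\<rho> z) s \<le> \<bar>k\<bar> * \<eta>" using s by (intro mult_left_mono) auto
      also have "\<bar>k\<bar> * \<eta> < (\<bar>k\<bar> + 1) * \<eta>" using \<eta> by simp
      also have "\<dots> = \<epsilon> - dist (z0 + l) z" by (simp add: \<eta>_def)
      finally show ?thesis by simp
    qed
    ultimately have "z \<in> G' (\<rho> z)" unfolding G'_def nb_def by (intro UN_I) auto
    then show False using rank[OF z] by blast
  qed
  define v where "v = (\<lambda>x. (1 / d x) *\<^sub>R x)"
  define I where "I = \<rho> ` U"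
  have v_dist: "\<bar>a\<bar> \<le> norm (a *\<^sub>R v x + s)" if x: "x \<in> I" and s: "s \<in> span (S x)" for a x s
  proof (cases "a = 0")
    case False
    have dx: "0 < d x" using x dpos by (auto simp: I_def)
    have "- (d x / a) *\<^sub>R s \<in> span (S x)" by (intro span_scale s)
    then have "d x \<le> dist x (- (d x / a) *\<^sub>R s)" unfolding d_def[THEN fun_cong, of x] by (rule infdist_le)
    also have "\<dots> = norm ((d x / a) *\<^sub>R (a *\<^sub>R v x + s))"
      using dx False by (simp add: dist_norm v_def scaleR_add_right)
    also have "\<dots> = d x / \<bar>a\<bar> * norm (a *\<^sub>R v x + s)" using dx by simp
    finally show ?thesis using dx False by (simp add: field_simps)
  qed simp
  have v_S: "v y \<in> span (S x)" if "lt y x" for x y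
    unfolding v_def using that by (intro span_scale span_base) (simp add: S_def)
  \<comment> \<open>The largest index that does not cancel decides: its net coefficient is at least
    1 in absolute value, and the other terms lie in the span of its predecessors. The weights 1 and
    2 differ so that the sum remembers which of \<open>a\<close> and \<open>b\<close> comes
    first.\<close>
  have sep: "1 \<le> norm (v a + 2 *\<^sub>R v b - v c - 2 *\<^sub>R v f)"
    if I: "a \<in> I" "b \<in> I" "c \<in> I" "f \<in> I" and ab: "lt a b" and neq: "\<not> (c = a \<and> f = b)" and cf: "lt c f" for a b c f
  proof -
    consider "b = f" "lt a c" | "b = f" "lt c a" | "lt b f" | "lt f b" using tri[of a c] tri[of b f] neq by blast
    then show ?thesis
    proof cases
      case 1
      then show ?thesis using v_dist[OF I(3) v_S[of a c], of "-1"] by simp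
    next
      case 2
      then show ?thesis using v_dist[OF I(1) span_neg[OF v_S[of c a]], of 1] by simp
    next
      case 3
      then have "v a + 2 *\<^sub>R v b - v c \<in> span (S f)"
        using 3 ab cf by (intro span_diff span_add span_scale v_S) (metis trans)+
      then show ?thesis using v_dist[OF I(4), of _ "-2"] by (fastforce simp: algebra_simps)
    next
      case 4
      then have "v a - v c - 2 *\<^sub>R v f \<in> span (S b)"
        using 4 ab cf by (intro span_diff span_add span_scale v_S) (metis trans)+
      then show ?thesis using v_dist[OF I(2), of _ "2"] by (fastforce simp: algebra_simps)
    qed
  qed
  define T where "T = (\<Union>p\<in>{p \<in> I \<times> I. lt (fst p) (snd p)}. {v (fst p) + 2 *\<^sub>R v (snd p)})"
  have T_closed: "closed T"
    unfolding T_def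
  proof (rule closed_Union_separated[of 1])
    fix p q x y
    assume "p \<in> {p \<in> I \<times> I. lt (fst p) (snd p)}" "q \<in> {p \<in> I \<times> I. lt (fst p) (snd p)}" "p \<noteq> q"
      "x \<in> {v (fst p) + 2 *\<^sub>R v (snd p)}" "y \<in> {v (fst q) + 2 *\<^sub>R v (snd q)}"
    then show "1 \<le> dist x y" using sep[of "fst p" "snd p" "fst q" "snd q"]
      by (cases p; cases q) (auto simp: dist_norm algebra_simps)
  qed auto
  have T_iff: "v a + 2 *\<^sub>R v b \<in> T \<longleftrightarrow> lt a b" if I: "a \<in> I" "b \<in> I" for a b
  proof
    show "v a + 2 *\<^sub>R v b \<in> T" if "lt a b" using I that by (auto simp: T_def)
    assume "v a + 2 *\<^sub>R v b \<in> T"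
    then obtain c f where cf: "c \<in> I" "f \<in> I" "lt c f" and eq: "v a + 2 *\<^sub>R v b = v c + 2 *\<^sub>R v f"
      by (auto simp: T_def)
    show "lt a b"
    proof (rule ccontr)
      assume nab: "\<not> lt a b"
      \<comment> \<open>The largest of the four indices is \<open>a\<close> or \<open>f\<close>. Its
        net coefficient in the successive cases is 3 or 1, then -1, 1 and -2; never being 0, it
        contradicts \<open>v_dist\<close> since the difference of the two sums vanishes.\<close>
      consider "lt f a" | "a = f" "lt b a" | "a = f" "a = b" | "lt a f" using tri[of a f] tri[of a b] nab by blast
      then show False
      proof cases
        case 1
        show False
        proof (cases "a = b")
          case True
          have "- v c - 2 *\<^sub>R v f \<in> span (S a)"
            using 1 cf by (intro span_diff span_neg span_scale v_S) (metis trans)+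
          moreover have "3 *\<^sub>R v a + (- v c - 2 *\<^sub>R v f) = (v a + 2 *\<^sub>R v b) - (v c + 2 *\<^sub>R v f)"
            using True scaleR_add_left[of 1 2 "v a"] by simp
          ultimately show False using v_dist[OF I(1), of _ 3] eq by fastforce
        next
          case False
          then have "2 *\<^sub>R v b - v c - 2 *\<^sub>R v f \<in> span (S a)"
            using 1 cf nab tri[of a b] False by (intro span_diff span_neg span_scale v_S) (metis trans)+
          moreover have "1 *\<^sub>R v a + (2 *\<^sub>R v b - v c - 2 *\<^sub>R v f) = 0"
            using eq by (simp add: algebra_simps)
          ultimately show False using v_dist[OF I(1), of _ 1] by fastforce
        qed
      next
        case 2
        then have "2 *\<^sub>R v b - v c \<in> span (S a)"
          using cf by (intro span_diff span_neg span_scale v_S) blast+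
        moreover have "(-1) *\<^sub>R v a + (2 *\<^sub>R v b - v c) = (v a + 2 *\<^sub>R v b) - (v c + 2 *\<^sub>R v f)"
          using 2 by (simp add: algebra_simps scaleR_2)
        ultimately show False using v_dist[OF I(1), of _ "-1"] eq by fastforce
      next
        case 3
        then have "- v c \<in> span (S a)"
          using cf by (intro span_neg v_S) blast+
        moreover have "1 *\<^sub>R v a + (- v c) = 0" using eq 3 by simp
        ultimately show False using v_dist[OF I(1), of _ 1] by fastforce
      next
        case 4
        then have "lt b f" using 4 nab tri[of a b] trans[of b a f] by blast
        then have "v a + 2 *\<^sub>R v b - v c \<in> span (S f)"
          using 4 cf by (intro span_diff span_add span_scale v_S) blast+
        moreover have "(-2) *\<^sub>R v f + (v a + 2 *\<^sub>R v b - v c) = 0" using eq by (simp add: algebra_simps)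
        ultimately show False using v_dist[OF cf(2), of _ "-2"] by fastforce
      qed
    qed
  qed
  have rank_sets: "{z \<in> U. \<rho> z \<in> A} \<in> sets \<mu>" for A
  proof -
    \<comment> \<open>\<open>F n x\<close> keeps the points of rank \<open>x\<close> at distance at
      least \<open>1 / (n + 1)\<close> from the complement of \<open>G x\<close>. A point of higher
      rank lies in that complement, so for fixed \<open>n\<close> the pieces are uniformly separated
      and their union over any set of ranks is closed.\<close>
    define F where "F = (\<lambda>n x. - (G' x \<union> B0 \<union> (\<Union>w\<in>- G x. ball w (1 / real (Suc n)))))"
    have "{z \<in> U. \<rho> z \<in> A} = (\<Union>n. \<Union>x\<in>A \<inter> J. F n x)"
    proof (intro equalityI subsetI)
      fix z assume z: "z \<in> {z \<in> U. \<rho> z \<in> A}"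
      then have zG: "z \<in> G (\<rho> z)" "z \<notin> G' (\<rho> z)" "\<rho> z \<in> J" using rank by auto
      have "open (G (\<rho> z))" by (simp add: G_def nb_open)
      then obtain s where s: "0 < s" "\<And>y. dist y z < s \<Longrightarrow> y \<in> G (\<rho> z)" using zG unfolding open_dist by blast
      obtain n where n: "1 / real (Suc n) < s" using s(1) nat_approx_posE by blast
      have "z \<in> F n (\<rho> z)" using zG z s n by (force simp: F_def U_def)
      then show "z \<in> (\<Union>n. \<Union>x\<in>A \<inter> J. F n x)" using z zG by auto
    next
      fix z assume "z \<in> (\<Union>n. \<Union>x\<in>A \<inter> J. F n x)"
      then obtain n x where x: "x \<in> A" "x \<in> J" "z \<in> F n x" by auto
      then have zG: "z \<in> G x" "z \<notin> G' x" "z \<notin> B0"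
        using centre_in_ball[of z "1 / real (Suc n)"] by (auto simp: F_def simp del: of_nat_Suc centre_in_ball mem_ball)
      moreover have "D x \<subseteq> J" using Jdown[OF x(2)] by (auto simp: D_def)
      ultimately have "z \<in> U" using nb_mono[OF span_mono[of "D x" J]] by (auto simp: U_def G_def)
      then show "z \<in> {z \<in> U. \<rho> z \<in> A}" using rank_eq zG x by auto
    qed
    moreover have "closed (\<Union>x\<in>A \<inter> J. F n x)" for n
    proof (rule closed_Union_separated[of "1 / real (Suc n)"])
      fix x assume "x \<in> A \<inter> J"
      show "closed (F n x)"
        unfolding F_def G'_def B0_def using nb_open by (intro closed_Compl open_Un open_UN) auto
    next
      have *: "1 / real (Suc n) \<le> dist z w" if "lt x y" "z \<in> F n x" "w \<in> F n y" for x y z w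
      proof -
        have "w \<notin> G x" using GG'[OF that(1)] that(3) by (auto simp: F_def)
        then have "z \<notin> ball w (1 / real (Suc n))" using that(2) by (auto simp: F_def)
        then show ?thesis by (simp add: dist_commute)
      qed
      fix x y z w assume "x \<noteq> y" "z \<in> F n x" "w \<in> F n y"
      then show "1 / real (Suc n) \<le> dist z w" using tri[of x y] *[of x y z w] *[of y x w z] by (auto simp: dist_commute)
    qed simp
    ultimately show ?thesis using sets by auto
  qed
  define f where "f = (\<lambda>z. if z \<in> U then v (\<rho> z) else 0)"
  have f_meas: "f \<in> \<mu> \<rightarrow>\<^sub>M borel"
  proof (rule measurableI)
    fix B :: "'a set" assume "B \<in> sets borel"
    have "f -` B \<inter> space \<mu> = {z \<in> U. \<rho> z \<in> {x. v x \<in> B}} \<union> (if 0 \<in> B then space \<mu> - U else {})"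
      using sp by (auto simp: f_def split: if_splits)
    then show "f -` B \<inter> space \<mu> \<in> sets \<mu>" using rank_sets[of "{x. v x \<in> B}"] U_sets by auto
  qed simp
  have h_meas: "(\<lambda>p. f (fst p) + 2 *\<^sub>R f (snd p)) \<in> \<mu> \<Otimes>\<^sub>M \<mu> \<rightarrow>\<^sub>M borel"
  proof -
    have "(\<lambda>x. 2 *\<^sub>R x) \<in> borel_measurable (borel :: 'a measure)"
      by (intro borel_measurable_continuous_onI continuous_intros)
    then have "(\<lambda>p. 2 *\<^sub>R f (snd p)) \<in> \<mu> \<Otimes>\<^sub>M \<mu> \<rightarrow>\<^sub>M borel"
      by (rule measurable_compose[OF measurable_compose[OF measurable_snd f_meas]])
    from measurable_Pair[OF measurable_compose[OF measurable_fst f_meas] this]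
    have "(\<lambda>p. (f (fst p), 2 *\<^sub>R f (snd p))) \<in> \<mu> \<Otimes>\<^sub>M \<mu> \<rightarrow>\<^sub>M borel \<Otimes>\<^sub>M borel" .
    from measurable_compose[OF this add] show ?thesis by simp
  qed
  \<comment> \<open>On \<open>U\<close> this says that the first point has smaller rank than the
    second. For fixed second point \<open>w\<close> the section lies in the null set
    \<open>G (\<rho> w)\<close>; for fixed first point \<open>z\<close> the section misses only a
    part of \<open>U\<close> inside the null set \<open>G (\<rho> z)\<close>. The iterated integrals
    are thus 0 and at least the square of the mass of \<open>U\<close>.\<close>
  define W where "W = {p \<in> space (\<mu> \<Otimes>\<^sub>M \<mu>). p \<in> U \<times> U \<and> f (fst p) + 2 *\<^sub>R f (snd p) \<in> T}"
  have W_sets: "W \<in> sets (\<mu> \<Otimes>\<^sub>M \<mu>)"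
  proof -
    have "W = (U \<times> U) \<inter> ((\<lambda>p. f (fst p) + 2 *\<^sub>R f (snd p)) -` T \<inter> space (\<mu> \<Otimes>\<^sub>M \<mu>))"
      by (auto simp: W_def)
    moreover have "(\<lambda>p. f (fst p) + 2 *\<^sub>R f (snd p)) -` T \<inter> space (\<mu> \<Otimes>\<^sub>M \<mu>) \<in> sets (\<mu> \<Otimes>\<^sub>M \<mu>)"
      by (intro measurable_sets[OF h_meas]) (use T_closed in auto)
    ultimately show ?thesis using U_sets by auto
  qed
  have W_iff: "(z, w) \<in> W \<longleftrightarrow> z \<in> U \<and> w \<in> U \<and> lt (\<rho> z) (\<rho> w)" for z w
    using T_iff[of "\<rho> z" "\<rho> w"] sp by (auto simp: W_def f_def I_def space_pair_measure)
  interpret P: pair_sigma_finite \<mu> \<mu> ..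
  have "emeasure (\<mu> \<Otimes>\<^sub>M \<mu>) W = (\<integral>\<^sup>+w. emeasure \<mu> ((\<lambda>z. (z, w)) -` W) \<partial>\<mu>)"
    by (rule P.emeasure_pair_measure_alt2[OF W_sets])
  also have "\<dots> = (\<integral>\<^sup>+w. 0 \<partial>\<mu>)"
  proof (intro nn_integral_cong)
    fix w
    show "emeasure \<mu> ((\<lambda>z. (z, w)) -` W) = 0"
    proof (cases "w \<in> U")
      case True
      have "(\<lambda>z. (z, w)) -` W \<subseteq> G (\<rho> w)"
        using rank Gmono asym by (auto simp: W_iff) blast
      then have "emeasure \<mu> ((\<lambda>z. (z, w)) -` W) \<le> emeasure \<mu> (G (\<rho> w))"
        using Gnull[OF rank(1)[OF True]] by (intro emeasure_mono) auto
      then show ?thesis using Gnull[OF rank(1)[OF True]] by auto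
    next
      case False
      then have "(\<lambda>z. (z, w)) -` W = {}" by (auto simp: W_iff)
      then show ?thesis by simp
    qed
  qed
  finally have W0: "emeasure (\<mu> \<Otimes>\<^sub>M \<mu>) W = 0" by simp
  have "(\<integral>\<^sup>+z. emeasure \<mu> U * indicator U z \<partial>\<mu>) \<le> (\<integral>\<^sup>+z. emeasure \<mu> (Pair z -` W) \<partial>\<mu>)"
  proof (intro nn_integral_mono)
    fix z
    show "emeasure \<mu> U * indicator U z \<le> emeasure \<mu> (Pair z -` W)"
    proof (cases "z \<in> U")
      case True
      have Wz: "Pair z -` W \<in> sets \<mu>" by (rule sets_Pair1[OF W_sets])
      have "U \<subseteq> Pair z -` W \<union> G (\<rho> z)"
        using rank Gmono True unfolding W_iff vimage_def by blast
      then have "emeasure \<mu> U \<le> emeasure \<mu> (Pair z -` W \<union> G (\<rho> z))"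
        using Wz Gnull[OF rank(1)[OF True]] by (intro emeasure_mono) auto
      also have "\<dots> = emeasure \<mu> (Pair z -` W)"
        using Wz Gnull[OF rank(1)[OF True]] by (rule emeasure_Un_null_set)
      finally show ?thesis using True by simp
    qed simp
  qed
  also have "\<dots> = emeasure (\<mu> \<Otimes>\<^sub>M \<mu>) W" by (rule emeasure_pair_measure_alt[OF W_sets, symmetric])
  finally have "emeasure \<mu> U * emeasure \<mu> U \<le> 0"
    using W0 U_sets by (simp add: nn_integral_cmult_indicator)
  then show False using U_pos by simp
qed


text \<open>Exhaustion: a countable \<open>C'\<close> covers the largest possible measure. On the
  remainder every ball of radius \<open>\<epsilon>\<close> is null, since adding its centre would
  otherwise beat the maximum; the previous lemma, applied to the restricted measure, makes the
  remainder null.\<close>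

lemma measurable_add_imp_countable_cover:
  fixes \<mu> :: "'a::real_normed_vector measure"
  assumes add: "(\<lambda>(x, y). x + y) \<in> borel \<Otimes>\<^sub>M borel \<rightarrow>\<^sub>M (borel :: 'a measure)"
    and fin: "finite_measure \<mu>" and sets: "sets \<mu> = sets borel" and e: "0 < \<epsilon>"
  shows "\<exists>C. countable C \<and> - (\<Union>c\<in>C. ball c \<epsilon>) \<in> null_sets \<mu>"
proof -
  interpret finite_measure \<mu> by fact
  define V :: "'a set \<Rightarrow> 'a set" where "V = (\<lambda>C. \<Union>c\<in>C. ball c \<epsilon>)"
  have Vs: "V C \<in> sets \<mu>" for C unfolding V_def sets by (intro borel_open open_UN) auto
  define A where "A = (\<lambda>C. emeasure \<mu> (V C)) ` {C. countable C}"
  obtain g :: "nat \<Rightarrow> ennreal" where g: "range g \<subseteq> A" "Sup A = (SUP i. g i)"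
  proof -
    have "A \<noteq> {}" using countable_empty unfolding A_def by blast
    then show thesis using ennreal_Sup_countable_SUP[of A] that by metis
  qed
  have "\<exists>C. countable C \<and> g i = emeasure \<mu> (V C)" for i
    using subsetD[OF g(1) rangeI[of g i]] unfolding A_def by blast
  then obtain C where C: "\<And>i. countable (C i)" "\<And>i. g i = emeasure \<mu> (V (C i))" by metis
  define C' where "C' = (\<Union>i. C i)"
  have C': "countable C'" using C by (auto simp: C'_def)
  have "g i \<le> emeasure \<mu> (V C')" for i
    unfolding C using Vs by (intro emeasure_mono) (auto simp: V_def C'_def)
  then have max: "Sup A \<le> emeasure \<mu> (V C')" unfolding g by (intro SUP_least)
  define R where "R = - V C'"
  have Rs: "R \<in> sets \<mu>" unfolding R_def V_def sets by (intro borel_closed closed_Compl open_UN) auto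
  define \<nu> where "\<nu> = density \<mu> (indicator R)"
  have \<nu>: "emeasure \<nu> B = emeasure \<mu> (R \<inter> B)" if "B \<in> sets \<mu>" for B
    unfolding \<nu>_def by (rule emeasure_restricted[OF Rs that])
  have "emeasure \<nu> (ball x \<epsilon>) = 0" for x
  proof -
    have b: "ball x \<epsilon> \<in> sets \<mu>" using sets by auto
    have "emeasure \<mu> (V C') + emeasure \<mu> (R \<inter> ball x \<epsilon>) = emeasure \<mu> (V C' \<union> (R \<inter> ball x \<epsilon>))"
      using Vs b Rs by (intro plus_emeasure) (auto simp: R_def)
    also have "\<dots> = emeasure \<mu> (V (insert x C'))" by (rule arg_cong[of _ _ "emeasure \<mu>"]) (auto simp: V_def R_def)
    also have "\<dots> \<le> Sup A" using C' by (intro Sup_upper) (auto simp: A_def)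
    also note max
    finally have "emeasure \<mu> (V C') + emeasure \<mu> (R \<inter> ball x \<epsilon>) \<le> emeasure \<mu> (V C') + 0" by simp
    then have "emeasure \<mu> (R \<inter> ball x \<epsilon>) = 0"
      using ennreal_add_left_cancel_le[of "emeasure \<mu> (V C')"] by simp
    then show ?thesis using \<nu>[OF b] by simp
  qed
  moreover have "finite_measure \<nu>" unfolding \<nu>_def by (rule finite_measure_restricted[OF Rs])
  ultimately have "emeasure \<nu> UNIV = 0"
    using sets by (intro measurable_add_null_balls_imp_null[OF add _ _ e]) (auto simp: \<nu>_def)
  then have "R \<in> null_sets \<mu>" using \<nu>[of UNIV] Rs sets by (auto simp: null_sets_def)
  then show ?thesis using C' unfolding R_def V_def by blast
qed

section \<open>Sums of independent identically distributed variables\<close>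

lemma measure_ball_lower_continuous:
  fixes \<nu> :: "'a::metric_space measure"
  assumes "finite_measure \<nu>" "sets \<nu> = sets borel" "a < measure \<nu> (ball z s)"
  obtains s' where "s' < s" "a < measure \<nu> (ball z s')"
proof -
  interpret finite_measure \<nu> by fact
  define A where "A = (\<lambda>i. ball z (s - 1 / real (Suc i)))"
  have "incseq A"
    unfolding A_def by (intro monoI subset_ball diff_left_mono divide_left_mono) auto
  moreover have "range A \<subseteq> sets \<nu>" unfolding A_def assms(2) by auto
  ultimately have "(\<lambda>i. measure \<nu> (A i)) \<longlonglongrightarrow> measure \<nu> (\<Union>i. A i)"
    by (intro finite_Lim_measure_incseq)
  moreover have "(\<Union>i. A i) = ball z s"
  proof (intro equalityI subsetI)
    fix x assume "x \<in> ball z s"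
    then obtain n where "1 / real (Suc n) < s - dist z x" using nat_approx_posE[of "s - dist z x"] by auto
    then have "x \<in> A n" by (simp add: A_def del: of_nat_Suc)
    then show "x \<in> (\<Union>i. A i)" by blast
  qed (auto simp: A_def intro: less_le_trans)
  ultimately have "\<forall>\<^sub>F i in sequentially. a < measure \<nu> (A i)"
    using assms(3) by (auto dest: order_tendstoD(1))
  then obtain i where "a < measure \<nu> (A i)" by (meson eventually_happens' sequentially_bot)
  then show thesis by (intro that[of "s - 1 / real (Suc i)"]) (auto simp: A_def)
qed

locale iid_sums = prob_space M for M :: "'b measure" +
  fixes X :: "nat \<Rightarrow> 'b \<Rightarrow> 'a::real_normed_vector"
  assumes add_measurable: "(\<lambda>(x, y). x + y) \<in> borel \<Otimes>\<^sub>M borel \<rightarrow>\<^sub>M (borel :: 'a measure)"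
    and X_measurable: "\<And>i. i \<ge> 1 \<Longrightarrow> X i \<in> borel_measurable M"
    and indep: "indep_vars (\<lambda>_. borel) X {1..}"
    and ident: "\<And>i. i \<ge> 1 \<Longrightarrow> distr M borel (X i) = distr M borel (X 1)"
begin

lemma measurable_plus:
  assumes "f \<in> N \<rightarrow>\<^sub>M borel" "g \<in> N \<rightarrow>\<^sub>M (borel :: 'a measure)"
  shows "(\<lambda>x. f x + g x) \<in> N \<rightarrow>\<^sub>M borel"
  using measurable_compose[OF measurable_Pair[OF assms] add_measurable] by (simp only: prod.case)

lemma measurable_setsum:
  assumes "finite A" "\<And>i. i \<in> A \<Longrightarrow> f i \<in> N \<rightarrow>\<^sub>M (borel :: 'a measure)"
  shows "(\<lambda>x. \<Sum>i\<in>A. f i x) \<in> N \<rightarrow>\<^sub>M borel"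
  using assms by (induction A) (auto intro: measurable_plus)

text \<open>The offset names the tail of a longer sum: \<open>S n m\<close> is independent of the
  first \<open>n\<close> terms and has the law of \<open>S 0 m\<close>.\<close>

definition S :: "nat \<Rightarrow> nat \<Rightarrow> 'b \<Rightarrow> 'a" where
  "S j k \<omega> = (\<Sum>i\<in>{j<..j + k}. X i \<omega>)"

lemma S_measurable [measurable]: "S j k \<in> borel_measurable M"
  unfolding S_def[abs_def] by (intro measurable_setsum X_measurable) auto

lemma S_Suc: "S j (Suc k) \<omega> = S j k \<omega> + X (j + Suc k) \<omega>"
proof -
  have "{j<..j + Suc k} = insert (j + Suc k) {j<..j + k}" by auto
  then show ?thesis by (simp add: S_def add.commute)
qed

lemma S_add: "S 0 (n + m) \<omega> = S 0 n \<omega> + S n m \<omega>"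
  by (induction m) (simp_all add: S_Suc add.assoc, simp add: S_def)

lemma indep_sums:
  assumes "finite A" "finite B" "A \<inter> B = {}" "A \<subseteq> {1..}" "B \<subseteq> {1..}"
  shows "indep_var borel (\<lambda>\<omega>. \<Sum>i\<in>A. X i \<omega>) borel (\<lambda>\<omega>. \<Sum>i\<in>B. X i \<omega>)"
proof -
  have *: "(\<lambda>f. \<Sum>i\<in>K. f i) \<in> PiM K (\<lambda>_. borel) \<rightarrow>\<^sub>M (borel :: 'a measure)" if "finite K" for K :: "nat set"
    using that by (intro measurable_setsum) auto
  have "indep_var borel ((\<lambda>f. \<Sum>i\<in>A. f i) \<circ> (\<lambda>\<omega>. restrict (\<lambda>i. X i \<omega>) A))
      borel ((\<lambda>f. \<Sum>i\<in>B. f i) \<circ> (\<lambda>\<omega>. restrict (\<lambda>i. X i \<omega>) B))"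
    using assms by (intro indep_var_compose[OF indep_var_restrict[OF indep]] *) auto
  then show ?thesis by (simp add: comp_def)
qed

text \<open>Each further term convolves with the law of \<open>X 1\<close>, so the offset drops out
  of the recursion.\<close>

lemma distr_S_shift: "distr M borel (S j k) = distr M borel (S 0 k)"
proof (induction k)
  case 0
  have "S j 0 = S 0 0" by (simp add: S_def fun_eq_iff)
  then show ?case by simp
next
  case (Suc k)
  have *: "distr M borel (S i (Suc k)) =
      distr (distr M borel (S i k) \<Otimes>\<^sub>M distr M borel (X 1)) borel (\<lambda>(x, y). x + y)" for i
  proof -
    have "indep_var borel (S i k) borel (X (i + Suc k))"
      using indep_sums[of "{i<..i + k}" "{i + Suc k}"] unfolding S_def[abs_def] by force
    then have pr: "distr M borel (S i k) \<Otimes>\<^sub>M distr M borel (X (i + Suc k)) =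
        distr M (borel \<Otimes>\<^sub>M borel) (\<lambda>\<omega>. (S i k \<omega>, X (i + Suc k) \<omega>))"
      by (simp add: indep_var_distribution_eq)
    have "distr (distr M (borel \<Otimes>\<^sub>M borel) (\<lambda>\<omega>. (S i k \<omega>, X (i + Suc k) \<omega>))) borel (\<lambda>(x, y). x + y)
        = distr M borel ((\<lambda>(x, y). x + y) \<circ> (\<lambda>\<omega>. (S i k \<omega>, X (i + Suc k) \<omega>)))"
      by (intro distr_distr add_measurable measurable_Pair S_measurable X_measurable) simp
    also have "(\<lambda>(x, y). x + y) \<circ> (\<lambda>\<omega>. (S i k \<omega>, X (i + Suc k) \<omega>)) = S i (Suc k)"
      by (simp add: fun_eq_iff S_Suc)
    finally show ?thesis using pr ident[of "i + Suc k"] by simp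
  qed
  show ?case unfolding * Suc ..
qed

text \<open>Sums are kept unnormalised: centres and radii of balls then simply add, and the scaling
  by \<open>n\<close> returns only in \<open>Xbar_ball\<close>.\<close>

definition law :: "nat \<Rightarrow> 'a measure" where
  "law n = distr M borel (S 0 n)"

lemma sets_law [simp, measurable_cong]: "sets (law n) = sets borel"
  and space_law [simp]: "space (law n) = UNIV"
  by (simp_all add: law_def)

lemma prob_space_law: "prob_space (law n)"
  unfolding law_def by (rule prob_space_distr) simp

lemma finite_measure_law: "finite_measure (law n)"
  using prob_space_law by (rule prob_space.finite_measure)

lemma measure_law: "A \<in> sets borel \<Longrightarrow> measure (law n) A = prob {\<omega> \<in> space M. S 0 n \<omega> \<in> A}"
  unfolding law_def by (subst measure_distr) (auto intro!: arg_cong[where f = prob])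

lemma law_1: "law 1 = distr M borel (X 1)"
proof -
  have "{0<..Suc 0} = {Suc 0}" by auto
  then have "S 0 1 = X 1" by (simp add: S_def fun_eq_iff)
  then show ?thesis by (simp add: law_def)
qed

lemma law_le_1: "measure (law n) A \<le> 1"
  by (rule prob_space.prob_le_1[OF prob_space_law])

lemma law_supermult:
  assumes [measurable]: "A \<in> sets borel" "B \<in> sets borel" "C \<in> sets borel"
    and sum: "\<And>a b. a \<in> A \<Longrightarrow> b \<in> B \<Longrightarrow> a + b \<in> C"
  shows "measure (law n) A * measure (law m) B \<le> measure (law (n + m)) C"
proof -
  have "indep_var borel (S 0 n) borel (S n m)"
    using indep_sums[of "{0<..0 + n}" "{n<..n + m}"] unfolding S_def[abs_def] by force
  from indep_varD[OF this assms(1,2)]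
  have "prob {\<omega> \<in> space M. S 0 n \<omega> \<in> A \<and> S n m \<omega> \<in> B} =
      prob {\<omega> \<in> space M. S 0 n \<omega> \<in> A} * prob {\<omega> \<in> space M. S n m \<omega> \<in> B}"
    by (simp add: vimage_def Int_def conj_commute)
  also have "prob {\<omega> \<in> space M. S n m \<omega> \<in> B} = measure (distr M borel (S n m)) B"
    by (subst measure_distr) (auto intro!: arg_cong[where f = prob])
  also have "\<dots> = measure (law m) B" by (simp only: distr_S_shift[of n m] law_def)
  finally have "measure (law n) A * measure (law m) B = prob {\<omega> \<in> space M. S 0 n \<omega> \<in> A \<and> S n m \<omega> \<in> B}"
    by (simp add: measure_law)
  also have "\<dots> \<le> prob {\<omega> \<in> space M. S 0 (n + m) \<omega> \<in> C}"
  proof -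
    have "{\<omega> \<in> space M. S 0 (n + m) \<omega> \<in> C} \<in> events" by measurable
    then show ?thesis using sum by (intro finite_measure_mono) (auto simp: S_add)
  qed
  finally show ?thesis by (simp add: measure_law)
qed

lemma law_supermult_ball:
  "measure (law n) (ball x r) * measure (law m) (ball y s) \<le> measure (law (n + m)) (ball (x + y) (r + s))"
proof (rule law_supermult)
  fix a b assume "a \<in> ball x r" "b \<in> ball y s"
  then have "dist (x + y) (a + b) < r + s" using dist_triangle_add[of x y a b] by simp
  then show "a + b \<in> ball (x + y) (r + s)" by simp
qed auto

text \<open>The case \<open>q = 0\<close> has to be excluded: the left side is then 1 and the ball
  on the right is empty.\<close>

lemma law_power_ball:
  "measure (law m) (ball x r) ^ q \<le> measure (law (q * m)) (ball (real q *\<^sub>R x) (real q * r))" if "0 < q"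
  using that
proof (induction q)
  case (Suc q)
  show ?case
  proof (cases "q = 0")
    case False
    have "measure (law m) (ball x r) ^ Suc q \<le>
        measure (law m) (ball x r) * measure (law (q * m)) (ball (real q *\<^sub>R x) (real q * r))"
      using Suc False by (auto intro: mult_left_mono)
    also have "\<dots> \<le> measure (law (m + q * m)) (ball (x + real q *\<^sub>R x) (r + real q * r))"
      by (rule law_supermult_ball)
    finally show ?thesis by (simp add: algebra_simps)
  qed simp
qed simp

lemma nn_integral_law_1_power:
  assumes g: "g \<in> borel_measurable borel"
  shows "(\<integral>\<^sup>+y. g y \<partial>law 1) ^ n = (\<integral>\<^sup>+\<omega>. (\<Prod>i\<in>{0<..n}. g (X i \<omega>)) \<partial>M)"
proof -
  have "(\<integral>\<^sup>+\<omega>. (\<Prod>i\<in>{0<..n}. g (X i \<omega>)) \<partial>M) = (\<Prod>i\<in>{0<..n}. \<integral>\<^sup>+\<omega>. g (X i \<omega>) \<partial>M)"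
  proof -
    have "{0<..n} \<subseteq> {1..}" by auto
    from indep_vars_compose2[OF indep_vars_subset[OF indep this], of "\<lambda>_. g" "\<lambda>_. borel"] g
    show ?thesis by (intro indep_vars_nn_integral) auto
  qed
  also have "\<dots> = (\<Prod>i\<in>{0<..n}. \<integral>\<^sup>+y. g y \<partial>law 1)"
  proof (rule prod.cong)
    fix i assume "i \<in> {0<..n}"
    then have i: "1 \<le> i" by auto
    have "(\<integral>\<^sup>+\<omega>. g (X i \<omega>) \<partial>M) = (\<integral>\<^sup>+y. g y \<partial>distr M borel (X i))"
      by (rule nn_integral_distr[OF X_measurable[OF i], symmetric]) (use g in simp)
    then show "(\<integral>\<^sup>+\<omega>. g (X i \<omega>) \<partial>M) = (\<integral>\<^sup>+y. g y \<partial>law 1)"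
      unfolding law_1 ident[OF i] .
  qed simp
  finally show ?thesis by simp
qed

lemma S_mean: "1 \<le> n \<Longrightarrow> S 0 n \<omega> = real n *\<^sub>R Xbar X n \<omega>"
  using atLeastSucAtMost_greaterThanAtMost[of 0 n] by (simp add: S_def Xbar_def)

lemma Xbar_measurable: "Xbar X n \<in> borel_measurable M"
proof (cases "n = 0")
  case False
  then have "(\<lambda>x::'a. (1 / real n) *\<^sub>R x) \<in> borel_measurable borel"
    by (intro borel_measurable_continuous_onI continuous_intros)
  moreover have "Xbar X n = (\<lambda>\<omega>. (1 / real n) *\<^sub>R S 0 n \<omega>)"
    using S_mean[of n] False by (simp add: fun_eq_iff)
  ultimately show ?thesis using measurable_compose[OF S_measurable] by metis
qed (simp add: Xbar_def[abs_def])

lemma Xbar_ball: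
  assumes "1 \<le> n"
  shows "prob {\<omega> \<in> space M. Xbar X n \<omega> \<in> ball x r} = measure (law n) (ball (real n *\<^sub>R x) (real n * r))"
proof -
  have "dist (real n *\<^sub>R x) (real n *\<^sub>R y) < real n * r \<longleftrightarrow> dist x y < r" for y
  proof -
    have "dist (real n *\<^sub>R x) (real n *\<^sub>R y) = real n * dist x y"
      by (simp add: dist_norm flip: scaleR_diff_right)
    then show ?thesis using assms by simp
  qed
  then show ?thesis by (simp add: measure_law S_mean[OF assms])
qed

end

section \<open>Weak large deviation principle and Chernoff bound\<close>

lemma log_prob_mono: "0 \<le> p \<Longrightarrow> p \<le> q \<Longrightarrow> log_prob p \<le> log_prob q"
  by (auto simp: log_prob_def)

lemma log_prob_le: "0 < n \<Longrightarrow> 0 \<le> p \<Longrightarrow> p \<le> exp (n * c) \<Longrightarrow> ereal (1 / n) * log_prob p \<le> ereal c"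
proof (cases "p = 0")
  case False
  assume *: "0 < n" "0 \<le> p" "p \<le> exp (n * c)"
  then have "ln p \<le> n * c" using False by (metis exp_le_cancel_iff exp_ln less_eq_real_def)
  then show ?thesis using * False by (simp add: log_prob_def field_simps)
qed (simp add: log_prob_def)

lemma le_exp_of_log_prob: "0 < n \<Longrightarrow> 0 \<le> p \<Longrightarrow> ereal (1 / n) * log_prob p \<le> ereal c \<Longrightarrow> p \<le> exp (n * c)"
proof (cases "p = 0")
  case False
  assume *: "0 < n" "0 \<le> p" "ereal (1 / n) * log_prob p \<le> ereal c"
  then have "ln p \<le> n * c" using False by (simp add: log_prob_def field_simps)
  then have "exp (ln p) \<le> exp (n * c)" by simp
  then show ?thesis using * False by simp
qed simp

context iid_sums
begin

text \<open>With \<open>n = q * m + k\<close>, each of the \<open>q\<close> full blocks falls into a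
  ball of radius \<open>m * r'\<close> with \<open>r' < r\<close>, and the remainder, which has one
  of finitely many lengths, falls into a fixed ball with probability above 1/2. For large
  \<open>n\<close> the slack \<open>n * (r - r')\<close> exceeds the radius of that ball. The factor
  1/2 is invisible on the exponential scale.\<close>

lemma eventually_law_ball_ge:
  assumes m: "1 \<le> m" and a: "0 < a" "a < measure (law m) (ball (real m *\<^sub>R x) (real m * r))"
  shows "\<forall>\<^sub>F n in sequentially. a powr (real n / real m) / 2 \<le> measure (law n) (ball (real n *\<^sub>R x) (real n * r))"
proof -
  obtain s where s: "s < real m * r" "a < measure (law m) (ball (real m *\<^sub>R x) s)"
    using measure_ball_lower_continuous[OF finite_measure_law sets_law a(2)] .
  define r' where "r' = s / real m"
  have r': "r' < r" "s = real m * r'" using s m by (auto simp: r'_def field_simps)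
  have "0 < s" by (rule ccontr) (use s(2) a(1) in \<open>simp add: ball_empty not_less\<close>)
  then have r'0: "0 < r'" using m by (simp add: r'_def)
  have a1: "a \<le> 1" using a law_le_1[of m] by (meson less_imp_le order_trans)
  have "\<exists>R. 1 / 2 < measure (law k) (ball (real k *\<^sub>R x) R)" for k
  proof -
    interpret finite_measure "law k" by (rule finite_measure_law)
    have "(\<lambda>i. measure (law k) (ball (real k *\<^sub>R x) (real i))) \<longlonglongrightarrow> measure (law k) (\<Union>i. ball (real k *\<^sub>R x) (real i))"
      by (intro finite_Lim_measure_incseq monoI subset_ball) auto
    moreover have "(\<Union>i. ball (real k *\<^sub>R x) (real i)) = UNIV"
      by (auto simp: reals_Archimedean2)
    moreover have "measure (law k) UNIV = 1"
      using prob_space.prob_space[OF prob_space_law, of k] by simp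
    ultimately have "\<forall>\<^sub>F i in sequentially. 1 / 2 < measure (law k) (ball (real k *\<^sub>R x) (real i))"
      by (intro order_tendstoD(1)[where y = 1]) auto
    then show ?thesis by (meson eventually_happens' sequentially_bot)
  qed
  then obtain R where R: "\<And>k. 1 / 2 < measure (law k) (ball (real k *\<^sub>R x) (R k))" by metis
  define R' where "R' = Max (R ` {..<m})"
  have R': "R k \<le> R'" if "k < m" for k using that by (auto simp: R'_def)
  have "a powr (real n / real m) / 2 \<le> measure (law n) (ball (real n *\<^sub>R x) (real n * r))"
    if n: "m \<le> n" "R' / (r - r') \<le> real n" for n
  proof -
    define q k where "q = n div m" and "k = n mod m"
    have qk: "n = q * m + k" "k < m" "0 < q" using n m by (auto simp: q_def k_def div_greater_zero_iff)
    have q: "real q \<le> real n / real m" using qk m by (simp add: field_simps flip: of_nat_mult)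
    \<comment> \<open>\<open>q\<close> may be smaller than \<open>n / m\<close>; lowering the
      exponent raises the power because \<open>a \<le> 1\<close>.\<close>
    have "a powr (real n / real m) \<le> a powr real q" using a a1 q by (intro powr_mono') auto
    also have "\<dots> = a ^ q" using a by (simp add: powr_realpow)
    also have "\<dots> \<le> measure (law m) (ball (real m *\<^sub>R x) s) ^ q" using a s by (intro power_mono) auto
    also have "\<dots> \<le> measure (law (q * m)) (ball (real q *\<^sub>R real m *\<^sub>R x) (real q * s))"
      by (rule law_power_ball[OF qk(3)])
    finally have 1: "a powr (real n / real m) \<le> measure (law (q * m)) (ball (real q *\<^sub>R real m *\<^sub>R x) (real q * s))" .
    have "a powr (real n / real m) / 2 =
        a powr (real n / real m) * (1 / 2)" by simp
    also have "\<dots> \<le> measure (law (q * m)) (ball (real q *\<^sub>R real m *\<^sub>R x) (real q * s)) *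
        measure (law k) (ball (real k *\<^sub>R x) (R k))"
      using 1 R[of k] by (intro mult_mono) auto
    also have "\<dots> \<le> measure (law (q * m + k)) (ball (real q *\<^sub>R real m *\<^sub>R x + real k *\<^sub>R x) (real q * s + R k))"
      by (rule law_supermult_ball)
    also have "real q *\<^sub>R real m *\<^sub>R x + real k *\<^sub>R x = real n *\<^sub>R x"
      unfolding qk(1) by (simp add: scaleR_add_left)
    also have "measure (law (q * m + k)) (ball (real n *\<^sub>R x) (real q * s + R k)) \<le>
        measure (law n) (ball (real n *\<^sub>R x) (real n * r))"
    proof -
      have "real q * s \<le> real n * r'" using q m r'0 unfolding r'(2) by (simp add: field_simps)
      moreover have "R k \<le> real n * (r - r')" using R'[OF qk(2)] n(2) r' by (simp add: field_simps)
      ultimately have "real q * s + R k \<le> real n * r" by (simp add: algebra_simps)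
      then show ?thesis
        unfolding qk(1)[symmetric]
        by (intro finite_measure.finite_measure_mono[OF finite_measure_law] subset_ball) auto
    qed
    finally show ?thesis .
  qed
  moreover have "\<forall>\<^sub>F n in sequentially. m \<le> n \<and> R' / (r - r') \<le> real n"
    by (intro eventually_conj eventually_ge_at_top filterlim_real_sequentially[unfolded filterlim_at_top, rule_format])
  ultimately show ?thesis by (auto elim: eventually_mono)
qed

text \<open>Fekete's lemma for the supermultiplicative sequence of ball probabilities. The ball is first
  shrunk slightly, so that the remainder of the division of \<open>n\<close> by \<open>m\<close> becomes harmless.\<close>

lemma log_prob_Xbar_ball_le_liminf:
  assumes m: "1 \<le> m"
  shows "ereal (1 / real m) * log_prob (prob {\<omega> \<in> space M. Xbar X m \<omega> \<in> ball x r}) \<le>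
    liminf (\<lambda>n. ereal (1 / real n) * log_prob (prob {\<omega> \<in> space M. Xbar X n \<omega> \<in> ball x r}))"
    (is "_ \<le> liminf ?f")
proof (rule dense_le)
  let ?P = "\<lambda>n. measure (law n) (ball (real n *\<^sub>R x) (real n * r))"
  fix y :: ereal assume y: "y < ereal (1 / real m) * log_prob (prob {\<omega> \<in> space M. Xbar X m \<omega> \<in> ball x r})"
  then have yP: "y < ereal (1 / real m) * log_prob (?P m)" using Xbar_ball[OF m] by simp
  show "y \<le> liminf ?f"
  proof (cases y)
    case (real u)
    have P: "?P m \<noteq> 0" using yP m by (auto simp: log_prob_def)
    then have "real m * u < ln (?P m)" using yP m real by (simp add: log_prob_def field_simps)
    then have a: "exp (real m * u) < ?P m"
      using P by (metis exp_less_cancel_iff exp_ln measure_nonneg order_less_le)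
    have "\<forall>\<^sub>F n in sequentially. ereal (u - ln 2 / real n) \<le> ?f n"
      using eventually_law_ball_ge[OF m exp_gt_zero a] eventually_gt_at_top[of 0]
    proof eventually_elim
      case (elim n)
      have "exp (real n * u) / 2 \<le> ?P n" using elim m by (simp add: powr_def)
      moreover from this have P0: "0 < ?P n" by (smt (verit) exp_gt_zero half_gt_zero)
      ultimately have "ln (exp (real n * u) / 2) \<le> ln (?P n)" by (subst ln_le_cancel_iff) auto
      then have "real n * u - ln 2 \<le> ln (?P n)" by (simp add: ln_div)
      then have "(real n * u - ln 2) / real n \<le> ln (?P n) / real n" by (rule divide_right_mono) simp
      then have "u - ln 2 / real n \<le> ln (?P n) / real n" using elim by (simp add: diff_divide_distrib)
      then show ?case using elim P0 Xbar_ball[of n x r] by (simp add: log_prob_def)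
    qed
    then have "liminf (\<lambda>n. ereal (u - ln 2 / real n)) \<le> liminf ?f" by (rule Liminf_mono)
    moreover have "(\<lambda>n. ereal (u - ln 2 / real n)) \<longlonglongrightarrow> ereal (u - 0)"
      by (intro tendsto_intros lim_const_over_n)
    ultimately show ?thesis using real by (simp add: lim_imp_Liminf)
  qed (use yP in auto)
qed

text \<open>By Fekete's argument the rate of a ball bounds its probability for every single
  \<open>n\<close>, with no constant and no threshold. Excluding 0 from the semigroup
  \<open>Q\<close> in \<open>ex_supporting_functional\<close> depends on this.\<close>

lemma ldp_entropy_less_ball:
  assumes "ldp_entropy M (Xbar X) x < ereal c"
  obtains r where "0 < r" "\<And>n. 1 \<le> n \<Longrightarrow> prob {\<omega> \<in> space M. Xbar X n \<omega> \<in> ball x r} \<le> exp (real n * c)"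
proof -
  obtain r where r: "0 < r"
    "liminf (\<lambda>n. ereal (1 / real n) * log_prob (prob {\<omega> \<in> space M. Xbar X n \<omega> \<in> ball x r})) < ereal c"
    using assms unfolding ldp_entropy_def INF_less_iff by auto
  have "prob {\<omega> \<in> space M. Xbar X n \<omega> \<in> ball x r} \<le> exp (real n * c)" if "1 \<le> n" for n
    using log_prob_Xbar_ball_le_liminf[OF that, of x r] r(2) that
    by (intro le_exp_of_log_prob) auto
  then show thesis using r(1) that by blast
qed

lemma Xbar_sets: "A \<in> sets borel \<Longrightarrow> {\<omega> \<in> space M. Xbar X n \<omega> \<in> A} \<in> events"
  using measurable_sets[OF Xbar_measurable, of A n] by (simp add: vimage_def Int_def conj_commute)

lemma weak_LDP_Xbar: "weak_LDP M (Xbar X) (ldp_entropy M (Xbar X))"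
  unfolding weak_LDP_def
proof (intro conjI ballI impI)
  fix G :: "'a set" assume G: "G \<in> sets borel"
  show "(SUP x\<in>interior G. ldp_entropy M (Xbar X) x) \<le>
      liminf (\<lambda>n. ereal (1 / real n) * log_prob (prob {\<omega> \<in> space M. Xbar X n \<omega> \<in> G}))"
  proof (rule SUP_least)
    fix x assume "x \<in> interior G"
    then obtain r where r: "0 < r" "ball x r \<subseteq> G" by (meson mem_interior)
    have "ldp_entropy M (Xbar X) x \<le>
        liminf (\<lambda>n. ereal (1 / real n) * log_prob (prob {\<omega> \<in> space M. Xbar X n \<omega> \<in> ball x r}))"
      unfolding ldp_entropy_def by (rule INF_lower) (use r in simp)
    also have "\<dots> \<le> liminf (\<lambda>n. ereal (1 / real n) * log_prob (prob {\<omega> \<in> space M. Xbar X n \<omega> \<in> G}))"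
      using r G
      by (intro Liminf_mono always_eventually allI ereal_mult_left_mono log_prob_mono finite_measure_mono Xbar_sets) auto
    finally show "ldp_entropy M (Xbar X) x \<le>
      liminf (\<lambda>n. ereal (1 / real n) * log_prob (prob {\<omega> \<in> space M. Xbar X n \<omega> \<in> G}))" .
  qed
next
  fix K :: "'a set" assume K: "K \<in> sets borel" and comp: "compact (closure K)"
  show "limsup (\<lambda>n. ereal (1 / real n) * log_prob (prob {\<omega> \<in> space M. Xbar X n \<omega> \<in> K})) \<le>
      (SUP x\<in>closure K. ldp_entropy M (Xbar X) x)"
  proof (rule dense_ge)
    fix y assume y: "(SUP x\<in>closure K. ldp_entropy M (Xbar X) x) < y"
    show "limsup (\<lambda>n. ereal (1 / real n) * log_prob (prob {\<omega> \<in> space M. Xbar X n \<omega> \<in> K})) \<le> y"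
    proof (cases y)
      case (real c)
      have "\<exists>r>0. \<forall>n\<ge>1. prob {\<omega> \<in> space M. Xbar X n \<omega> \<in> ball x r} \<le> exp (real n * c)"
        if "x \<in> closure K" for x
      proof -
        have "ldp_entropy M (Xbar X) x < ereal c"
          using y real SUP_upper[OF that, of "ldp_entropy M (Xbar X)"] by (metis le_less_trans)
        then show ?thesis using ldp_entropy_less_ball by metis
      qed
      then obtain r where r: "\<And>x. x \<in> closure K \<Longrightarrow> 0 < r x"
        "\<And>x n. x \<in> closure K \<Longrightarrow> 1 \<le> n \<Longrightarrow> prob {\<omega> \<in> space M. Xbar X n \<omega> \<in> ball x (r x)} \<le> exp (real n * c)"
        by metis
      have "closure K \<subseteq> (\<Union>x\<in>closure K. ball x (r x))" using r(1) by force
      then obtain F where F: "F \<subseteq> closure K" "finite F" "closure K \<subseteq> (\<Union>x\<in>F. ball x (r x))"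
        by (rule compactE_image[OF comp open_ball])
      \<comment> \<open>One more than the number of balls, so that \<open>N\<close> is positive even
        if \<open>F\<close> is empty.\<close>
      define N where "N = real (card F) + 1"
      have "\<forall>\<^sub>F n in sequentially. ereal (1 / real n) * log_prob (prob {\<omega> \<in> space M. Xbar X n \<omega> \<in> K})
          \<le> ereal (c + ln N / real n)"
        using eventually_gt_at_top[of 0]
      proof eventually_elim
        case (elim n)
        have "prob {\<omega> \<in> space M. Xbar X n \<omega> \<in> K} \<le> prob (\<Union>x\<in>F. {\<omega> \<in> space M. Xbar X n \<omega> \<in> ball x (r x)})"
        proof (intro finite_measure_mono sets.finite_UN Xbar_sets F)
          have "K \<subseteq> (\<Union>x\<in>F. ball x (r x))" using F closure_subset[of K] by (meson order_trans)
          then show "{\<omega> \<in> space M. Xbar X n \<omega> \<in> K} \<subseteq> (\<Union>x\<in>F. {\<omega> \<in> space M. Xbar X n \<omega> \<in> ball x (r x)})"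
            by blast
        qed simp
        also have "\<dots> \<le> (\<Sum>x\<in>F. prob {\<omega> \<in> space M. Xbar X n \<omega> \<in> ball x (r x)})"
          using F(2) by (intro finite_measure_subadditive_finite image_subsetI Xbar_sets) auto
        also have "\<dots> \<le> (\<Sum>x\<in>F. exp (real n * c))" using F elim by (intro sum_mono r) auto
        also have "\<dots> \<le> N * exp (real n * c)" by (simp add: N_def)
        also have "\<dots> = exp (ln N + real n * c)" by (simp add: N_def exp_add add_nonneg_pos)
        also have "ln N + real n * c = real n * (c + ln N / real n)" using elim by (simp add: field_simps)
        finally show ?case using elim by (intro log_prob_le) auto
      qed
      then have "limsup (\<lambda>n. ereal (1 / real n) * log_prob (prob {\<omega> \<in> space M. Xbar X n \<omega> \<in> K})) \<le>
          limsup (\<lambda>n. ereal (c + ln N / real n))"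
        by (rule Limsup_mono)
      moreover have "(\<lambda>n. ereal (c + ln N / real n)) \<longlonglongrightarrow> ereal (c + 0)"
        by (intro tendsto_intros lim_const_over_n)
      ultimately show ?thesis using real by (simp add: lim_imp_Limsup)
    qed (use y in auto)
  qed
qed

section \<open>Exponential moments and Chernoff's bound\<close>

lemma bounded_linear_measurable:
  "bounded_linear l \<Longrightarrow> l \<in> borel_measurable (borel :: 'a measure)" for l :: "'a \<Rightarrow> real"
  by (intro borel_measurable_continuous_onI linear_continuous_on)

lemma nn_integral_exp_law:
  assumes l: "bounded_linear l"
  shows "(\<integral>\<^sup>+y. ennreal (exp (l y)) \<partial>law n) = (\<integral>\<^sup>+y. ennreal (exp (l y)) \<partial>law 1) ^ n"
proof -
  interpret bounded_linear l by fact
  note [measurable] = bounded_linear_measurable[OF l]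
  have "(\<integral>\<^sup>+y. ennreal (exp (l y)) \<partial>law n) = (\<integral>\<^sup>+\<omega>. ennreal (exp (l (S 0 n \<omega>))) \<partial>M)"
    unfolding law_def by (subst nn_integral_distr) auto
  also have "\<dots> = (\<integral>\<^sup>+\<omega>. (\<Prod>i\<in>{0<..n}. ennreal (exp (l (X i \<omega>)))) \<partial>M)"
    by (intro nn_integral_cong) (simp add: S_def sum exp_sum prod_ennreal)
  also have "\<dots> = (\<integral>\<^sup>+y. ennreal (exp (l y)) \<partial>law 1) ^ n"
    by (rule nn_integral_law_1_power[symmetric]) measurable
  finally show ?thesis .
qed

lemma log_mgf_law: "bounded_linear l \<Longrightarrow> log_mgf M X l =
    (let I = (\<integral>\<^sup>+y. ennreal (exp (l y)) \<partial>law 1) in if I = \<infinity> then \<infinity> else ereal (ln (enn2real I)))"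
proof -
  assume l: "bounded_linear l"
  note [measurable] = bounded_linear_measurable[OF l]
  have "(\<integral>\<^sup>+\<omega>. ennreal (exp (l (X 1 \<omega>))) \<partial>M) = (\<integral>\<^sup>+y. ennreal (exp (l y)) \<partial>law 1)"
    unfolding law_1 using X_measurable[of 1] by (subst nn_integral_distr) auto
  then show ?thesis by (simp add: log_mgf_def)
qed

lemma nn_integral_exp_law_pos: 
  assumes l: "bounded_linear l"
  shows "(\<integral>\<^sup>+y. ennreal (exp (l y)) \<partial>law 1) \<noteq> 0"
proof
  note [measurable] = bounded_linear_measurable[OF l]
  interpret L: prob_space "law 1" by (rule prob_space_law)
  assume "(\<integral>\<^sup>+y. ennreal (exp (l y)) \<partial>law 1) = 0"
  then have "AE y in law 1. ennreal (exp (l y)) = 0" by (subst (asm) nn_integral_0_iff_AE) auto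
  then have "AE y in law 1. False" by (auto elim!: eventually_mono)
  then show False using L.AE_False by simp
qed

lemma ldp_entropy_le_legendre: "ldp_entropy M (Xbar X) x \<le> - legendre M X x"
proof -
  have "ereal (l x) - log_mgf M X l \<le> - ldp_entropy M (Xbar X) x" if l: "bounded_linear l" for l
  proof -
    interpret bounded_linear l by fact
    note [measurable] = bounded_linear_measurable[OF l]
    let ?I = "\<integral>\<^sup>+y. ennreal (exp (l y)) \<partial>law 1"
    show ?thesis
    proof (cases "?I = \<infinity>")
      case True
      then show ?thesis using log_mgf_law[OF l] by simp
    next
      case False
      define p where "p = ln (enn2real ?I)"
      have I: "?I = ennreal (exp p)"
        using False nn_integral_exp_law_pos[OF l] by (cases ?I) (auto simp: p_def less_le)
      obtain C where C: "0 < C" "\<And>h. \<bar>l h\<bar> \<le> norm h * C" using pos_bounded by auto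
      have "ldp_entropy M (Xbar X) x \<le> ereal (p - l x) + ereal \<epsilon>" if \<epsilon>: "0 < \<epsilon>" for \<epsilon>
      proof -
        \<comment> \<open>On a ball of radius \<open>n * r\<close> a functional with bound
          \<open>C\<close> differs from its value at the centre by at most
          \<open>n * \<epsilon>\<close>.\<close>
        define r where "r = \<epsilon> / C"
        have r: "0 < r" "r * C = \<epsilon>" using \<epsilon> C by (auto simp: r_def)
        have "ereal (1 / real n) * log_prob (prob {\<omega> \<in> space M. Xbar X n \<omega> \<in> ball x r}) \<le> ereal (p - l x + \<epsilon>)"
          if n: "1 \<le> n" for n
        proof -
          let ?B = "ball (real n *\<^sub>R x) (real n * r)"
          have "ennreal (exp (real n * (l x - \<epsilon>)) * measure (law n) ?B) =
              (\<integral>\<^sup>+y. ennreal (exp (real n * (l x - \<epsilon>))) * indicator ?B y \<partial>law n)"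
            using finite_measure.emeasure_eq_measure[OF finite_measure_law, of n ?B]
            by (simp add: nn_integral_cmult_indicator ennreal_mult')
          also have "\<dots> \<le> (\<integral>\<^sup>+y. ennreal (exp (l y)) \<partial>law n)"
          proof (rule nn_integral_mono)
            fix y
            have "real n * (l x - \<epsilon>) \<le> l y" if "y \<in> ?B"
            proof -
              have "l (real n *\<^sub>R x - y) \<le> norm (real n *\<^sub>R x - y) * C" using C(2) abs_le_D1 by blast
              also have "\<dots> \<le> real n * r * C" using that C(1) by (intro mult_right_mono) (auto simp: dist_norm)
              also have "\<dots> = real n * \<epsilon>" using r(2) by simp
              finally show ?thesis by (simp add: diff scaleR right_diff_distrib)
            qed
            then show "ennreal (exp (real n * (l x - \<epsilon>))) * indicator ?B y \<le> ennreal (exp (l y))"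
              by (auto simp: indicator_def intro!: ennreal_leI)
          qed
          also have "\<dots> = ?I ^ n" by (rule nn_integral_exp_law[OF l])
          also have "\<dots> = ennreal (exp (real n * p))"
            unfolding I by (simp add: ennreal_power exp_of_nat_mult)
          finally have "exp (real n * (l x - \<epsilon>)) * measure (law n) ?B \<le> exp (real n * p)"
            by (subst (asm) ennreal_le_iff) auto
          then have "measure (law n) ?B \<le> exp (real n * p) / exp (real n * (l x - \<epsilon>))"
            by (simp add: field_simps)
          also have "\<dots> = exp (real n * (p - l x + \<epsilon>))"
            by (simp add: algebra_simps flip: exp_diff)
          finally show ?thesis using n Xbar_ball[OF n] by (intro log_prob_le) auto
        qed
        then have "\<forall>\<^sub>F n in sequentially.
            ereal (1 / real n) * log_prob (prob {\<omega> \<in> space M. Xbar X n \<omega> \<in> ball x r}) \<le> ereal (p - l x + \<epsilon>)"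
          by (auto intro: eventually_sequentiallyI)
        then have "liminf (\<lambda>n. ereal (1 / real n) * log_prob (prob {\<omega> \<in> space M. Xbar X n \<omega> \<in> ball x r}))
            \<le> liminf (\<lambda>n. ereal (p - l x + \<epsilon>))"
          by (rule Liminf_mono)
        then have "ldp_entropy M (Xbar X) x \<le> ereal (p - l x + \<epsilon>)"
          unfolding ldp_entropy_def using r(1) by (intro INF_lower2[of r]) (auto simp: Liminf_const)
        then show ?thesis by simp
      qed
      then have "ldp_entropy M (Xbar X) x \<le> ereal (p - l x)" by (rule ereal_le_epsilon2)
      then have "- ereal (p - l x) \<le> - ldp_entropy M (Xbar X) x" by (simp only: ereal_minus_le_minus)
      moreover have "log_mgf M X l = ereal p" using False log_mgf_law[OF l] by (simp add: p_def)
      ultimately show ?thesis by simp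
    qed
  qed
  then have "legendre M X x \<le> - ldp_entropy M (Xbar X) x"
    unfolding legendre_def by (intro SUP_least) auto
  then have "- (- ldp_entropy M (Xbar X) x) \<le> - legendre M X x" by (simp only: ereal_minus_le_minus)
  then show ?thesis by simp
qed

end

section \<open>Convex duality\<close>

text \<open>The factor \<open>N\<close> disappears on taking \<open>n\<close>-th roots. In the
  application it is the number of balls of a cover that does not depend on \<open>n\<close>.\<close>

lemma le_of_power_le_mult_power:
  fixes a :: ennreal and b N :: real
  assumes b: "0 < b" and N: "0 \<le> N" and le: "\<And>n. 1 \<le> n \<Longrightarrow> a ^ n \<le> ennreal (N * b ^ n)"
  shows "a \<le> ennreal b"
proof -
  have "a \<noteq> \<infinity>" using le[of 1] by (auto simp: top_unique)
  then obtain r where r: "a = ennreal r" "0 \<le> r" by (cases a) auto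
  have *: "r ^ n \<le> N * b ^ n" if "1 \<le> n" for n
    using le[OF that] r b N ennreal_le_iff[of "N * b ^ n" "r ^ n"] by (simp add: ennreal_power)
  have "r \<le> b"
  proof (rule ccontr)
    assume "\<not> r \<le> b"
    then have "1 < r / b" using b by simp
    then obtain n where n: "N < (r / b) ^ n" using real_arch_pow by blast
    have "(r / b) ^ n \<le> (r / b) ^ Suc n" using \<open>1 < r / b\<close> by (intro power_increasing) auto
    then have "N < (r / b) ^ Suc n" using n by simp
    then have "N * b ^ Suc n < r ^ Suc n" using b by (simp add: power_divide pos_less_divide_eq del: power_Suc)
    then show False using *[of "Suc n"] by simp
  qed
  then show ?thesis using r by (simp add: ennreal_leI)
qed

context iid_sums
begin

text \<open>The convex hull of finitely many points is totally bounded, so no completeness or tightness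
  is needed: the measure is exhausted by convex sets covered by finitely many balls of a fixed radius.\<close>

lemma nn_integral_exp_le:
  assumes l: "bounded_linear l" and \<rho>: "0 < \<rho>"
    and ball: "\<And>n z w. 1 \<le> n \<Longrightarrow> w \<in> ball z (real n * \<rho>) \<Longrightarrow>
      exp (l w) * measure (law n) (ball z (real n * \<rho>)) \<le> exp (real n * c)"
  shows "(\<integral>\<^sup>+y. ennreal (exp (l y)) \<partial>law 1) \<le> ennreal (exp c)"
proof -
  interpret l: bounded_linear l by fact
  note [measurable] = bounded_linear_measurable[OF l]
  interpret L: prob_space "law 1" by (rule prob_space_law)
  obtain C where C: "countable C" "- (\<Union>c\<in>C. ball c (\<rho> / 2)) \<in> null_sets (law 1)"
    using measurable_add_imp_countable_cover[OF add_measurable finite_measure_law sets_law, of "\<rho> / 2" 1] \<rho> by auto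
  have "C \<noteq> {}"
  proof
    assume "C = {}"
    then have "emeasure (law 1) (space (law 1)) = 0" using C(2) by auto
    then show False using L.emeasure_space_1 by simp
  qed
  define e where "e = from_nat_into C"
  have e: "range e = C" unfolding e_def by (rule range_from_nat_into[OF \<open>C \<noteq> {}\<close> C(1)])
  define H where "H = (\<lambda>m::nat. convex hull (e ` {..m}))"
  \<comment> \<open>Written as a Minkowski sum, \<open>K m\<close> is visibly convex; rewritten as a
    union of balls in \<open>K_eq\<close>, it is open and hence Borel.\<close>
  define K where "K = (\<lambda>m. \<Union>x\<in>H m. \<Union>y\<in>ball 0 (\<rho> / 2). {x + y})"
  have K_eq: "K m = (\<Union>x\<in>H m. ball x (\<rho> / 2))" for m
  proof -
    have "(\<Union>y\<in>ball 0 (\<rho> / 2). {x + y}) = ball x (\<rho> / 2)" for x :: 'a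
      by (simp add: UNION_singleton_eq_range image_add_ball)
    then show ?thesis by (simp add: K_def)
  qed
  have K_sets [measurable]: "K m \<in> sets borel" for m unfolding K_eq by (intro borel_open open_UN) auto
  have K_convex: "convex (K m)" for m
    unfolding K_def H_def by (intro convex_sums convex_convex_hull convex_ball)
  have "incseq K"
    unfolding K_eq H_def by (intro monoI UN_mono hull_mono) auto
  have K_bound: "(\<integral>\<^sup>+y. ennreal (exp (l y)) * indicator (K m) y \<partial>law 1) \<le> ennreal (exp c)" for m
  proof -
    \<comment> \<open>A net of mesh \<open>\<rho> / 2\<close> for the compact hull and the
      thickening by \<open>\<rho> / 2\<close> add up to the radius \<open>\<rho>\<close> of the
      hypothesis \<open>ball\<close>.\<close>
    have "compact (H m)" unfolding H_def by (rule finite_imp_compact_convex_hull) simp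
    then obtain F where F: "finite F" "H m \<subseteq> (\<Union>x\<in>F. ball x (\<rho> / 2))"
      using seq_compact_imp_totally_bounded[of "H m"] \<rho> by (metis compact_imp_seq_compact half_gt_zero)
    have KF: "K m \<subseteq> (\<Union>x\<in>F. ball x \<rho>)"
    proof
      fix y assume "y \<in> K m"
      then obtain x where x: "x \<in> H m" "dist x y < \<rho> / 2" by (auto simp: K_eq)
      then obtain z where z: "z \<in> F" "dist z x < \<rho> / 2" using F(2) by auto
      have "dist z y \<le> dist z x + dist x y" by (rule dist_triangle)
      then show "y \<in> (\<Union>x\<in>F. ball x \<rho>)" using x z by (intro UN_I[of z]) auto
    qed
    show ?thesis
    proof (rule le_of_power_le_mult_power)
      fix n :: nat assume n: "1 \<le> n"
      let ?B = "\<lambda>x. ball (real n *\<^sub>R x) (real n * \<rho>)"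
      have hm: "(\<lambda>y. ennreal (exp (l y)) * indicator (?B x) y) \<in> borel_measurable borel" for x
      proof (intro borel_measurable_times_ennreal borel_measurable_indicator)
        show "(\<lambda>y. ennreal (exp (l y))) \<in> borel_measurable borel" by measurable
      qed simp
      \<comment> \<open>The hypothesis controls the product of \<open>exp (l w)\<close> and the mass
        of the ball, uniformly in \<open>w\<close>, and this dominates the integral over the ball. A
        null ball is set apart because the bound on \<open>exp (l y)\<close> comes from dividing by
        the mass.\<close>
      have one: "(\<integral>\<^sup>+y. ennreal (exp (l y)) * indicator (?B x) y \<partial>law n) \<le> ennreal (exp c ^ n)" for x
      proof (cases "measure (law n) (?B x) = 0")
        case True
        then have "AE y in law n. y \<notin> ?B x"
          by (intro AE_not_in) (simp add: null_sets_def finite_measure.emeasure_eq_measure[OF finite_measure_law])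
        then have "(\<integral>\<^sup>+y. ennreal (exp (l y)) * indicator (?B x) y \<partial>law n) = (\<integral>\<^sup>+y. 0 \<partial>law n)"
          by (intro nn_integral_cong_AE) (auto elim!: eventually_mono)
        then show ?thesis by simp
      next
        case False
        define p where "p = measure (law n) (?B x)"
        have p: "0 < p" using False by (simp add: p_def less_le)
        have "(\<integral>\<^sup>+y. ennreal (exp (l y)) * indicator (?B x) y \<partial>law n) \<le>
            (\<integral>\<^sup>+y. ennreal (exp (real n * c) / p) * indicator (?B x) y \<partial>law n)"
        proof (rule nn_integral_mono)
          fix y
          have "exp (l y) \<le> exp (real n * c) / p" if "y \<in> ?B x"
            using ball[OF n that] p by (simp add: p_def field_simps)
          then show "ennreal (exp (l y)) * indicator (?B x) y \<le> ennreal (exp (real n * c) / p) * indicator (?B x) y"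
            by (auto simp: indicator_def intro!: ennreal_leI)
        qed
        also have "\<dots> = ennreal (exp (real n * c) / p) * ennreal p"
          by (simp add: nn_integral_cmult_indicator p_def finite_measure.emeasure_eq_measure[OF finite_measure_law])
        also have "\<dots> = ennreal (exp c ^ n)" using p by (simp add: exp_of_nat_mult flip: ennreal_mult)
        finally show ?thesis .
      qed
      have "(\<integral>\<^sup>+y. ennreal (exp (l y)) * indicator (K m) y \<partial>law 1) ^ n =
          (\<integral>\<^sup>+\<omega>. (\<Prod>i\<in>{0<..n}. ennreal (exp (l (X i \<omega>))) * indicator (K m) (X i \<omega>)) \<partial>M)"
        by (intro nn_integral_law_1_power) measurable
      also have "\<dots> \<le> (\<integral>\<^sup>+\<omega>. (\<Sum>x\<in>F. ennreal (exp (l (S 0 n \<omega>))) * indicator (?B x) (S 0 n \<omega>)) \<partial>M)"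
      proof (rule nn_integral_mono)
        fix \<omega>
        show "(\<Prod>i\<in>{0<..n}. ennreal (exp (l (X i \<omega>))) * indicator (K m) (X i \<omega>)) \<le>
            (\<Sum>x\<in>F. ennreal (exp (l (S 0 n \<omega>))) * indicator (?B x) (S 0 n \<omega>))"
        proof (cases "\<forall>i\<in>{0<..n}. X i \<omega> \<in> K m")
          case True
          have "(\<Prod>i\<in>{0<..n}. ennreal (exp (l (X i \<omega>))) * indicator (K m) (X i \<omega>)) =
              (\<Prod>i\<in>{0<..n}. ennreal (exp (l (X i \<omega>))))"
            using True by (intro prod.cong) auto
          also have "\<dots> = ennreal (exp (l (S 0 n \<omega>)))" by (simp add: S_def l.sum exp_sum prod_ennreal)
          finally have eq: "(\<Prod>i\<in>{0<..n}. ennreal (exp (l (X i \<omega>))) * indicator (K m) (X i \<omega>)) =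
              ennreal (exp (l (S 0 n \<omega>)))" .
          have "(\<Sum>i\<in>{0<..n}. (1 / real n) *\<^sub>R X i \<omega>) \<in> K m"
            using n True by (intro convex_sum K_convex) auto
          then obtain x where x: "x \<in> F" "dist x ((1 / real n) *\<^sub>R S 0 n \<omega>) < \<rho>"
            using KF by (auto simp: S_def scaleR_sum_right)
          have "dist (real n *\<^sub>R x) (S 0 n \<omega>) = norm (real n *\<^sub>R (x - (1 / real n) *\<^sub>R S 0 n \<omega>))"
            using n by (simp add: dist_norm scaleR_diff_right)
          also have "\<dots> = real n * dist x ((1 / real n) *\<^sub>R S 0 n \<omega>)" by (simp add: dist_norm)
          also have "\<dots> < real n * \<rho>" using x n by simp
          finally have "S 0 n \<omega> \<in> ?B x" by simp
          then have "ennreal (exp (l (S 0 n \<omega>))) = ennreal (exp (l (S 0 n \<omega>))) * indicator (?B x) (S 0 n \<omega>)" by simp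
          also have "\<dots> \<le> (\<Sum>x\<in>F. ennreal (exp (l (S 0 n \<omega>))) * indicator (?B x) (S 0 n \<omega>))"
            using F(1) x(1) by (intro member_le_sum) auto
          finally show ?thesis unfolding eq .
        next
          case False
          then obtain i where i: "i \<in> {0<..n}" "X i \<omega> \<notin> K m" by auto
          then have "(\<Prod>i\<in>{0<..n}. ennreal (exp (l (X i \<omega>))) * indicator (K m) (X i \<omega>)) = 0"
            by (intro prod_zero) (auto intro!: bexI[of _ i])
          then show ?thesis by (simp only: zero_le)
        qed
      qed
      also have "\<dots> = (\<Sum>x\<in>F. \<integral>\<^sup>+\<omega>. ennreal (exp (l (S 0 n \<omega>))) * indicator (?B x) (S 0 n \<omega>) \<partial>M)"
        using measurable_compose[OF S_measurable hm] by (intro nn_integral_sum)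
      also have "\<dots> = (\<Sum>x\<in>F. \<integral>\<^sup>+y. ennreal (exp (l y)) * indicator (?B x) y \<partial>law n)"
        unfolding law_def using hm by (intro sum.cong refl nn_integral_distr[symmetric] S_measurable) simp
      also have "\<dots> \<le> (\<Sum>x\<in>F. ennreal (exp c ^ n))" by (intro sum_mono one)
      also have "\<dots> = ennreal (real (card F) * exp c ^ n)"
        by (simp add: ennreal_mult' ennreal_of_nat_eq_real_of_nat)
      finally show "(\<integral>\<^sup>+y. ennreal (exp (l y)) * indicator (K m) y \<partial>law 1) ^ n
          \<le> ennreal (real (card F) * exp c ^ n)" .
    qed simp_all
  qed
  have "(\<integral>\<^sup>+y. ennreal (exp (l y)) \<partial>law 1) = (\<integral>\<^sup>+y. (SUP m. ennreal (exp (l y)) * indicator (K m) y) \<partial>law 1)"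
  proof (rule nn_integral_cong_AE)
    have "AE y in law 1. y \<notin> - (\<Union>c\<in>C. ball c (\<rho> / 2))" by (rule AE_not_in[OF C(2)])
    then show "AE y in law 1. ennreal (exp (l y)) = (SUP m. ennreal (exp (l y)) * indicator (K m) y)"
    proof eventually_elim
      case (elim y)
      then obtain m where "y \<in> ball (e m) (\<rho> / 2)" using e by auto
      then have "y \<in> K m" unfolding K_eq H_def by (intro UN_I[of "e m"] hull_inc) auto
      then have "ennreal (exp (l y)) * indicator (K m) y = ennreal (exp (l y))" by simp
      then show ?case
        by (intro antisym SUP_least) (auto intro!: SUP_upper2[of m] simp: indicator_def)
    qed
  qed
  also have "\<dots> = (SUP m. \<integral>\<^sup>+y. ennreal (exp (l y)) * indicator (K m) y \<partial>law 1)"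
  proof (rule nn_integral_monotone_convergence_SUP)
    show "incseq (\<lambda>m y. ennreal (exp (l y)) * indicator (K m) y)"
      using \<open>incseq K\<close> by (auto simp: incseq_def le_fun_def indicator_def)
    show "(\<lambda>y. ennreal (exp (l y)) * indicator (K m) y) \<in> borel_measurable (law 1)" for m
      by measurable
  qed
  also have "\<dots> \<le> ennreal (exp c)" by (intro SUP_least K_bound)
  finally show ?thesis .
qed

end

section \<open>Supporting functionals and the lower bound for the entropy\<close>

context iid_sums
begin

text \<open>The countable cover rules out that all balls of radius \<open>\<rho>\<close> are null.
  This is what makes the semigroup of the next lemma nonempty.\<close>

lemma ex_law_ball_pos:
  assumes "0 < \<rho>"
  obtains z where "0 < measure (law n) (ball z \<rho>)"
proof -
  interpret L: prob_space "law n" by (rule prob_space_law)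
  obtain C where C: "countable C" "- (\<Union>c\<in>C. ball c \<rho>) \<in> null_sets (law n)"
    using measurable_add_imp_countable_cover[OF add_measurable finite_measure_law sets_law assms, of n] by auto
  have "\<exists>z. measure (law n) (ball z \<rho>) \<noteq> 0"
  proof (rule ccontr)
    assume "\<not> ?thesis"
    then have "(\<Union>c\<in>C. ball c \<rho>) \<in> null_sets (law n)"
      using C(1) by (intro null_sets_UN') (auto simp: null_sets_def L.emeasure_eq_measure)
    then have "(\<Union>c\<in>C. ball c \<rho>) \<union> - (\<Union>c\<in>C. ball c \<rho>) \<in> null_sets (law n)" using C(2) by (rule null_sets.Un)
    then have "space (law n) \<in> null_sets (law n)" by (simp only: Compl_partition space_law)
    then show False using L.emeasure_space_1 by (simp add: null_sets_def)
  qed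
  then show thesis using that by (auto simp: less_le)
qed

text \<open>Hahn--Banach is applied in \<open>'a \<times> real\<close> to the open semigroup of all
  \<open>n \<cdot> (x - y, t - u)\<close> where \<open>x\<close> is the centre of a ball of radius \<open>\<rho>\<close> hit by
  \<open>Xbar X n\<close> with probability greater than \<open>exp (- n t)\<close>, where \<open>y\<close> is close to \<open>x0\<close>
  and \<open>u < c\<close>. Keeping the radius \<open>\<rho>\<close> fixed instead of separating from the epigraph of
  the entropy itself makes the completion of the space superfluous: the entropy may be identically
  \<open>- \<infinity>\<close> on an incomplete space.\<close>

lemma ex_supporting_functional:
  assumes \<rho>: "0 < \<rho>"
    and small: "\<And>n. 1 \<le> n \<Longrightarrow> measure (law n) (ball (real n *\<^sub>R x0) (real n * (3 * \<rho>))) \<le> exp (- (real n * c))"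
  shows "\<exists>l. bounded_linear l \<and> (\<integral>\<^sup>+y. ennreal (exp (l y)) \<partial>law 1) \<le> ennreal (exp (l x0 - c))"
proof -
  \<comment> \<open>The margin \<open>2 * \<rho>\<close> has two uses: \<open>\<rho>\<close> reaches
    every point of the ball around \<open>z\<close>, and the rest leaves room for the shift
    \<open>k\<close> in the case \<open>\<alpha> = 0\<close>. Together with the radius
    \<open>\<rho>\<close> of the ball it gives the \<open>3 * \<rho>\<close> of the hypothesis
    \<open>small\<close>.\<close>
  define R where "R = (\<lambda>n z t. {p :: 'a \<times> real. dist z (fst p + real n *\<^sub>R x0) < real n * (2 * \<rho>) \<and> t - real n * c < snd p})"
  define I where "I = {(n, z, t). 1 \<le> n \<and> exp (- t) < measure (law n) (ball z (real n * \<rho>))}"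
  define Q where "Q = (\<Union>(n, z, t)\<in>I. R n z t)"
  have Q_iff: "p \<in> Q \<longleftrightarrow> (\<exists>n z t. 1 \<le> n \<and> exp (- t) < measure (law n) (ball z (real n * \<rho>)) \<and> p \<in> R n z t)" for p
    by (auto simp: Q_def I_def)
  have "open (R n z t)" for n z t
    unfolding R_def by (intro open_Collect_conj open_Collect_less continuous_intros)
  then have "open Q" unfolding Q_def by auto
  obtain z1 where z1: "0 < measure (law 1) (ball z1 \<rho>)" using ex_law_ball_pos[OF \<rho>] .
  define t1 where "t1 = 1 - ln (measure (law 1) (ball z1 \<rho>))"
  have exp_less: "exp (- (e - ln p)) < p" if "0 < e" "0 < p" for e p :: real
  proof -
    have "exp (- (e - ln p)) < exp (ln p)" using that(1) by simp
    then show ?thesis using that(2) by simp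
  qed
  have t1: "exp (- t1) < measure (law 1) (ball z1 \<rho>)"
    unfolding t1_def by (rule exp_less[OF zero_less_one z1])
  have Q1: "(z1 - x0, t1 - c + s) \<in> Q" if "0 < s" for s
    unfolding Q_iff R_def using t1 \<rho> that by (intro exI[of _ 1] exI[of _ z1] exI[of _ t1]) simp
  \<comment> \<open>Membership of 0 would place, inside the ball of \<open>small\<close>, a smaller
    ball with more mass than \<open>small\<close> allows.\<close>
  have "0 \<notin> Q"
  proof
    assume "0 \<in> Q"
    then obtain n z t where n: "1 \<le> n" and P: "exp (- t) < measure (law n) (ball z (real n * \<rho>))"
      and d: "dist z (real n *\<^sub>R x0) < real n * (2 * \<rho>)" and t: "t - real n * c < 0"
      by (auto simp: Q_iff R_def)
    have "ball z (real n * \<rho>) \<subseteq> ball (real n *\<^sub>R x0) (real n * (3 * \<rho>))"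
    proof
      fix y assume "y \<in> ball z (real n * \<rho>)"
      moreover have "dist (real n *\<^sub>R x0) y \<le> dist z (real n *\<^sub>R x0) + dist z y" by (rule dist_triangle3)
      ultimately show "y \<in> ball (real n *\<^sub>R x0) (real n * (3 * \<rho>))" using d by (simp add: algebra_simps)
    qed
    then have "measure (law n) (ball z (real n * \<rho>)) \<le> measure (law n) (ball (real n *\<^sub>R x0) (real n * (3 * \<rho>)))"
      by (intro finite_measure.finite_measure_mono[OF finite_measure_law]) auto
    also have "\<dots> \<le> exp (- (real n * c))" by (rule small[OF n])
    also have "\<dots> < exp (- t)" using t by simp
    finally show False using P by simp
  qed
  moreover have "p + q \<in> Q" if pq: "p \<in> Q" "q \<in> Q" for p q
  proof -
    obtain n z t where n: "1 \<le> n" "exp (- t) < measure (law n) (ball z (real n * \<rho>))" "p \<in> R n z t"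
      using pq(1) by (auto simp: Q_iff)
    obtain m w u where m: "1 \<le> m" "exp (- u) < measure (law m) (ball w (real m * \<rho>))" "q \<in> R m w u"
      using pq(2) by (auto simp: Q_iff)
    have "exp (- (t + u)) = exp (- t) * exp (- u)" by (simp flip: exp_add)
    also have "\<dots> < measure (law n) (ball z (real n * \<rho>)) * measure (law m) (ball w (real m * \<rho>))"
      using n m by (intro mult_strict_mono') auto
    also have "\<dots> \<le> measure (law (n + m)) (ball (z + w) (real n * \<rho> + real m * \<rho>))" by (rule law_supermult_ball)
    also have "real n * \<rho> + real m * \<rho> = real (n + m) * \<rho>" by (simp add: algebra_simps)
    finally have "exp (- (t + u)) < measure (law (n + m)) (ball (z + w) (real (n + m) * \<rho>))" .
    moreover have "p + q \<in> R (n + m) (z + w) (t + u)"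
      using n(3) m(3) dist_triangle_add[of z w "fst p + real n *\<^sub>R x0" "fst q + real m *\<^sub>R x0"]
      by (simp add: R_def algebra_simps)
    ultimately show ?thesis unfolding Q_iff using n(1) by (intro exI conjI) auto
  qed
  moreover have "Q \<noteq> {}" using Q1[of 1] by auto
  ultimately obtain f :: "'a \<times> real \<Rightarrow> real" where f: "bounded_linear f" and fpos: "\<And>p. p \<in> Q \<Longrightarrow> 0 < f p"
    using open_semigroup_positive_functional[OF \<open>open Q\<close>] by metis
  interpret f: bounded_linear f by fact
  define g where "g = (\<lambda>v. f (v, 0))"
  define \<alpha> where "\<alpha> = f (0, 1)"
  have g: "bounded_linear g"
    unfolding g_def
    by (rule bounded_linear_compose[OF f]) (intro bounded_linear_Pair bounded_linear_ident bounded_linear_zero)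
  interpret g: bounded_linear g by fact
  have f_eq: "f (v, s) = g v + \<alpha> * s" for v s
    using f.add[of "(v, 0)" "s *\<^sub>R (0, 1)"] f.scaleR[of s "(0, 1)"] by (simp add: g_def \<alpha>_def mult.commute)
  \<comment> \<open>The second coordinate can be increased without bound inside \<open>Q\<close>, as
    in \<open>Q1\<close>.\<close>
  have \<alpha>: "0 \<le> \<alpha>"
  proof (rule ccontr)
    assume "\<not> 0 \<le> \<alpha>"
    define s where "s = (\<bar>g (z1 - x0) + \<alpha> * (t1 - c)\<bar> + 1) / - \<alpha>"
    have "0 < s" unfolding s_def using \<open>\<not> 0 \<le> \<alpha>\<close> by (intro divide_pos_pos) auto
    from fpos[OF Q1[OF this]] have "0 < g (z1 - x0) + \<alpha> * (t1 - c) + \<alpha> * s" by (simp add: f_eq algebra_simps)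
    moreover have "\<alpha> * s = - (\<bar>g (z1 - x0) + \<alpha> * (t1 - c)\<bar> + 1)" using \<open>\<not> 0 \<le> \<alpha>\<close> by (simp add: s_def)
    ultimately show False by linarith
  qed
  \<comment> \<open>Positivity on \<open>Q\<close> in the limit \<open>s\<close> to 0 of the last
    coordinate; \<open>h\<close> is the displacement permitted by the margin.\<close>
  have key: "0 \<le> g z - real n * g x0 + g h + \<alpha> * (t - real n * c)"
    if n: "1 \<le> n" and P: "exp (- t) < measure (law n) (ball z (real n * \<rho>))" and h: "norm h < real n * (2 * \<rho>)" for n z t h
  proof (rule field_le_epsilon)
    fix e :: real assume e: "0 < e"
    define s where "s = e / (\<alpha> + 1)"
    have s: "0 < s" "\<alpha> * s \<le> e" using e \<alpha> by (auto simp: s_def field_simps)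
    have "(z - real n *\<^sub>R x0 + h, t - real n * c + s) \<in> Q"
      unfolding Q_iff R_def using n P h s(1) by (intro exI[of _ n] exI[of _ z] exI[of _ t]) (simp add: dist_norm)
    from fpos[OF this] show "0 \<le> g z - real n * g x0 + g h + \<alpha> * (t - real n * c) + e"
      using s(2) by (simp add: f_eq g.add g.diff g.scaleR algebra_simps)
  qed
  show ?thesis
  proof (cases "\<alpha> = 0")
    case False
    then have \<alpha>': "0 < \<alpha>" using \<alpha> by simp
    \<comment> \<open>The slope of a nonvertical hyperplane, with the sign that turns positivity on
      \<open>Q\<close> into an upper bound for \<open>l w + ln P\<close>.\<close>
    define l where "l = (\<lambda>v. - (1 / \<alpha>) * g v)"
    have l: "bounded_linear l" unfolding l_def by (intro bounded_linear_const_mult g)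
    have "exp (l w) * measure (law n) (ball z (real n * \<rho>)) \<le> exp (real n * (l x0 - c))"
      if n: "1 \<le> n" and w: "w \<in> ball z (real n * \<rho>)" for n z w
    proof (cases "measure (law n) (ball z (real n * \<rho>)) = 0")
      case False
      define P where "P = measure (law n) (ball z (real n * \<rho>))"
      have P: "0 < P" using False by (simp add: P_def less_le)
      have "l w + ln P \<le> real n * (l x0 - c)"
      proof (rule field_le_epsilon)
        fix e :: real assume e: "0 < e"
        have "exp (- (e - ln P)) < P" by (rule exp_less[OF e P])
        moreover have "norm (w - z) < real n * (2 * \<rho>)"
        proof -
          have "norm (w - z) < real n * \<rho>" using w by (simp add: dist_norm norm_minus_commute)
          also have "\<dots> \<le> real n * (2 * \<rho>)" using \<rho> by (intro mult_left_mono) auto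
          finally show ?thesis .
        qed
        ultimately have "0 \<le> g z - real n * g x0 + g (w - z) + \<alpha> * (e - ln P - real n * c)"
          using n unfolding P_def by (intro key) auto
        then have "0 \<le> (g w - real n * g x0 + \<alpha> * (e - ln P - real n * c)) / \<alpha>"
          using \<alpha>' by (simp add: g.diff)
        also have "\<dots> = - l w + real n * l x0 + (e - ln P - real n * c)"
          using \<alpha>' by (simp add: l_def add_divide_distrib diff_divide_distrib)
        finally show "l w + ln P \<le> real n * (l x0 - c) + e" by (simp add: algebra_simps)
      qed
      then have "exp (l w + ln P) \<le> exp (real n * (l x0 - c))" by simp
      then show ?thesis using P by (simp add: exp_add P_def)
    qed simp
    then show ?thesis using nn_integral_exp_le[OF l \<rho>] l by blast
  next
    \<comment> \<open>The vertical case: almost surely \<open>g y\<close> exceeds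
      \<open>g x0\<close> by at least the fixed amount \<open>g k\<close>, so the law of
      \<open>X 1\<close> lies strictly on one side of \<open>x0\<close>. A multiple of
      \<open>- g\<close> by a factor \<open>s\<close> with \<open>s * g k = \<bar>c\<bar>\<close>
      then reaches the level \<open>c\<close>.\<close>
    case True
    obtain v where v: "0 < g v" using fpos[OF Q1[of 1]] True by (auto simp: f_eq)
    have v0: "0 < norm v" using v g.zero by auto
    define k where "k = (\<rho> / (2 * norm v)) *\<^sub>R v"
    have k: "norm k < \<rho>" "0 < g k" using v v0 \<rho> by (auto simp: k_def g.scaleR)
    obtain C where C: "countable C" "- (\<Union>c\<in>C. ball c \<rho>) \<in> null_sets (law 1)"
      using measurable_add_imp_countable_cover[OF add_measurable finite_measure_law sets_law \<rho>, of 1] by auto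
    define C0 where "C0 = {z \<in> C. measure (law 1) (ball z \<rho>) = 0}"
    have "(\<Union>z\<in>C0. ball z \<rho>) \<in> null_sets (law 1)"
      using C(1) by (intro null_sets_UN')
        (auto simp: C0_def null_sets_def finite_measure.emeasure_eq_measure[OF finite_measure_law] intro: countable_subset)
    then have "AE y in law 1. y \<notin> (\<Union>z\<in>C0. ball z \<rho>)" by (rule AE_not_in)
    moreover have "AE y in law 1. y \<notin> - (\<Union>c\<in>C. ball c \<rho>)" by (rule AE_not_in[OF C(2)])
    ultimately have AE: "AE y in law 1. g x0 + g k \<le> g y"
    proof eventually_elim
      case (elim y)
      then obtain z where z: "z \<in> C" "dist z y < \<rho>" "measure (law 1) (ball z \<rho>) \<noteq> 0" by (auto simp: C0_def)
      define P where "P = measure (law 1) (ball z \<rho>)"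
      have P: "0 < P" using z by (simp add: P_def less_le)
      have "exp (- (1 - ln P)) < P" by (rule exp_less[OF zero_less_one P])
      moreover have "norm ((y - z) - k) < 2 * \<rho>"
        using norm_triangle_ineq4[of "y - z" k] z(2) k(1) by (simp add: dist_norm norm_minus_commute)
      ultimately have "0 \<le> g z - g x0 + g ((y - z) - k)"
        using key[of 1 "1 - ln P" z "(y - z) - k"] True by (simp add: P_def)
      then show ?case by (simp add: g.diff)
    qed
    define s where "s = \<bar>c\<bar> / g k"
    define l where "l = (\<lambda>y. - s * g y)"
    have l: "bounded_linear l" unfolding l_def by (intro bounded_linear_const_mult g)
    have s: "0 \<le> s" "s * g k = \<bar>c\<bar>" using k by (auto simp: s_def)
    have "(\<integral>\<^sup>+y. ennreal (exp (l y)) \<partial>law 1) \<le> (\<integral>\<^sup>+y. ennreal (exp (l x0 - c)) \<partial>law 1)"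
    proof (rule nn_integral_mono_AE)
      show "AE y in law 1. ennreal (exp (l y)) \<le> ennreal (exp (l x0 - c))"
        using AE
      proof eventually_elim
        case (elim y)
        then have "s * (g x0 + g k) \<le> s * g y" using s(1) by (rule mult_left_mono)
        then have "l y \<le> l x0 - c" using s(2) by (simp add: l_def algebra_simps)
        then show ?case by (intro ennreal_leI) simp
      qed
    qed
    also have "\<dots> = ennreal (exp (l x0 - c))"
      using prob_space.emeasure_space_1[OF prob_space_law, of 1] by simp
    finally show ?thesis using l by blast
  qed
qed

lemma legendre_le_ldp_entropy: "- legendre M X x \<le> ldp_entropy M (Xbar X) x"
proof (rule dense_ge)
  fix y assume y: "ldp_entropy M (Xbar X) x < y"
  show "- legendre M X x \<le> y"
  proof (cases y)
    case (real u)
    obtain r where r: "0 < r" "\<And>n. 1 \<le> n \<Longrightarrow> prob {\<omega> \<in> space M. Xbar X n \<omega> \<in> ball x r} \<le> exp (real n * u)"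
      using ldp_entropy_less_ball y real by metis
    \<comment> \<open>The level is \<open>c = - u\<close>, and the radius \<open>r / 3\<close> makes
      \<open>3 * \<rho>\<close> equal to \<open>r\<close>. The bound reads
      \<open>log_mgf M X l \<le> l x + u\<close>, so this \<open>l\<close> alone pushes
      \<open>legendre M X x\<close> up to \<open>- u\<close>.\<close>
    obtain l where l: "bounded_linear l" "(\<integral>\<^sup>+y. ennreal (exp (l y)) \<partial>law 1) \<le> ennreal (exp (l x - - u))"
      using ex_supporting_functional[of "r / 3" x "- u"] r Xbar_ball[of _ x r] by auto
    let ?I = "\<integral>\<^sup>+y. ennreal (exp (l y)) \<partial>law 1"
    obtain i where i: "?I = ennreal i" "0 < i" "i \<le> exp (l x + u)"
      using l(2) nn_integral_exp_law_pos[OF l(1)] by (cases ?I) (auto simp: less_le top_unique)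
    have "ln i \<le> l x + u" using i by (metis ln_exp ln_le_cancel_iff exp_gt_zero)
    moreover have "log_mgf M X l = ereal (ln i)" using i log_mgf_law[OF l(1)] by simp
    ultimately have "ereal (- u) \<le> ereal (l x) - log_mgf M X l" by simp
    also have "\<dots> \<le> legendre M X x" unfolding legendre_def by (rule SUP_upper) (use l in simp)
    finally have "- legendre M X x \<le> - ereal (- u)" by (simp only: ereal_minus_le_minus)
    then show ?thesis using real by simp
  qed (use y in auto)
qed

end

theorem theorem4p6:
  fixes M :: "'b measure" and X :: "nat \<Rightarrow> 'b \<Rightarrow> 'a::real_normed_vector"
  assumes "prob_space M"
    and "(\<lambda>(x, y). x + y) \<in> borel \<Otimes>\<^sub>M borel \<rightarrow>\<^sub>M (borel :: 'a measure)"
    and "\<And>i. i \<ge> 1 \<Longrightarrow> X i \<in> borel_measurable M"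
    and "prob_space.indep_vars M (\<lambda>_. borel) X {1..}"
    and "\<And>i. i \<ge> 1 \<Longrightarrow> distr M borel (X i) = distr M borel (X 1)"
  shows "weak_LDP M (Xbar X) (ldp_entropy M (Xbar X)) \<and>
         ldp_entropy M (Xbar X) = (\<lambda>x. - legendre M X x)"
proof -
  interpret iid_sums M X
    using assms by (intro iid_sums.intro iid_sums_axioms.intro)
  show ?thesis
    using weak_LDP_Xbar ldp_entropy_le_legendre legendre_le_ldp_entropy by (auto intro: antisym)
qed

end
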